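(* Fix an integer $n\ge1$, and let $m\ge 2$, $k\ge 1$, $p\ge 0$, $q\ge 0$ be integers. Consider the following diagram of graded rings, in which every horizontal and vertical arrow is the canonical projection described in the context: $$\begin{array}{ccccccc} \Lambda&\to&\Lambda_{m+p,\cdot}&\to&\Lambda_{m,\cdot}&\to&\Lambda_{m-1,\cdot}\\ \downarrow&&\downarrow&&\downarrow&&\downarrow\\ \Lambda_{\cdot,k+q}&\to&\Lambda_{m+p,k+q}&\to&\Lambda_{m,k+q}&\to&\Lambda_{m-1,k+q}\\ \downarrow&&\downarrow&&\downarrow&&\downarrow\\ \Lambda_{\cdot,k}&\to&\Lambda_{m+p,k}&\to&\Lambda_{m,k}&\to&\Lambda_{m-1,k}\\ \downarrow&&\downarrow&&\downarrow&&\downarrow\\ \Lambda_{\cdot,k-1}&\to&\Lambda_{m+p,k-1}&\to&\Lambda_{m,k-1}&\to&\Lambda_{m-1,k-1} \end{array}$$ This diagram is commutative in the sense that every one of its squares is commutative.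
   Context: Indeterminates: for integers $p\ge 1$, $d\ge 0$ and $1\le\mu_1,\dots,\mu_d\le n$ let $\mathbf a_{p\mu_1\dots\mu_d}$ be independent indeterminates (for $d=0$ this is $\mathbf a_p$). For $m\ge1$, $k\ge0$, $\Lambda_{m,k}$ is the graded ring of symmetric polynomials over $\mathbb Z$ in the indeterminates $\mathbf a_{p\mu_1\dots\mu_d}$ with $1\le p\le m$, $0\le d\le k$ (invariant under all permutations of these indeterminates), $\Lambda_{m,k}^r$ its homogeneous part of degree $r$. Projections: $h_{m+1,k}:\Lambda_{m+1,k}\to\Lambda_{m,k}$ sets $\mathbf a_{(m+1)\mu_1\dots\mu_d}=0$ for all $0\le d\le k$ and all $\mu_i$; $v_{m,k+1}:\Lambda_{m,k+1}\to\Lambda_{m,k}$ sets $\mathbf a_{p\mu_1\dots\mu_{k+1}}=0$ for all $1\le p\le m$ and all $\mu_i$. For $1\le m_1\le m_2$ and $0\le k_1\le k_2$: $\phi_{(m_2,m_1),k}=h_{m_1+1,k}\circ\dots\circ h_{m_2,k}:\Lambda_{m_2,k}\to\Lambda_{m_1,k}$ and $\psi_{m,(k_2,k_1)}=v_{m,k_1+1}\circ\dots\circ v_{m,k_2}:\Lambda_{m,k_2}\to\Lambda_{m,k_1}$ (identities when the two indices agree). Limits: $\Lambda_{\cdot,k}=\bigoplus_r\varprojlim_m\Lambda^r_{m,k}$ (along the $h$'s, $m\geq 1$) and $\Lambda_{m,\cdot}=\bigoplus_r\varprojlim_k\Lambda^r_{m,k}$ (along the $v$'s, $k\geq 0$),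 realized as compatible sequences, with canonical projections $H_{m,k}:\Lambda_{\cdot,k}\to\Lambda_{m,k}$ and $V_{m,k}:\Lambda_{m,\cdot}\to\Lambda_{m,k}$. The maps $\phi_{(m_2,m_1)}:\Lambda_{m_2,\cdot}\to\Lambda_{m_1,\cdot}$ and $\psi_{(k_2,k_1)}:\Lambda_{\cdot,k_2}\to\Lambda_{\cdot,k_1}$ are obtained by applying $\phi_{(m_2,m_1),k}$, respectively $\psi_{m,(k_2,k_1)}$, to each term of a compatible sequence. $\Lambda$ is the graded ring of symmetric functions over $\mathbb Z$ in all the indeterminates $\mathbf a_{p\mu_1\dots\mu_d}$ ($p\ge1$, $d\ge0$), i.e. the common inverse limit, in graded rings, of the $\Lambda_{m,\cdot}$ and of the $\Lambda_{\cdot,k}$; $H_m:\Lambda\to\Lambda_{m,\cdot}$ sets to zero all indeterminates with $p>m$, and $V_k:\Lambda\to\Lambda_{\cdot,k}$ sets to zero all indeterminates with $d>k$. Arrows of the diagram. Horizontal: top row $H_{m+p}$, $\phi_{(m+p,m)}$, $\phi_{(m,m-1)}$; in the row of second index $l\in\{k+q,k,k-1\}$: $H_{m+p,l}$, $\phi_{(m+p,m),l}$, $\phi_{(m,m-1),l}=h_{m,l}$. Vertical: leftmost column $V_{k+q}$, $\psi_{(k+q,k)}$, $\psi_{(k,k-1)}$; in the column of first index $j\in\{m+p,m,m-1\}$: $V_{j,k+q}$, $\psi_{j,(k+q,k)}$, $\psi_{j,(k,k-1)}=v_{j,k}$. *)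

theory Defs
  imports "HOL-Algebra.Ring" "HOL-Library.Poly_Mapping" "HOL-Combinatorics.Permutations"
begin

section \<open>Graded rings, commutative squares and inverse limits\<close>

record 'a graded_ring = "'a ring" +
  piece :: "nat \<Rightarrow> 'a set"

locale graded_cring = cring R for R (structure) +
  assumes piece_subgroup: "subgroup (piece R r) (add_monoid R)"
    and piece_one: "\<one> \<in> piece R 0"
    and piece_mult: "\<lbrakk>x \<in> piece R r; y \<in> piece R s\<rbrakk> \<Longrightarrow> x \<otimes> y \<in> piece R (r + s)"
    and piece_direct: "x \<in> carrier R \<Longrightarrow>
      \<exists>!c. (\<forall>r. c r \<in> piece R r) \<and> finite {r. c r \<noteq> \<zero>} \<and> x = (\<Oplus>r\<in>{r. c r \<noteq> \<zero>}. c r)"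

definition graded_hom ::
  "('a, 'm) graded_ring_scheme \<Rightarrow> ('b, 'l) graded_ring_scheme \<Rightarrow> ('a \<Rightarrow> 'b) set" where
  "graded_hom R S = {f \<in> ring_hom R S. \<forall>r. f ` piece R r \<subseteq> piece S r}"

text \<open>The arguments are laid out as the square: top row \<open>f: A \<rightarrow> B\<close>, the two vertical arrows
  \<open>a: A \<rightarrow> C\<close> and \<open>b: B \<rightarrow> D\<close>, bottom row \<open>g: C \<rightarrow> D\<close>.
  Commutativity is equality on the elements of \<open>A\<close>, as the values of the arrows outside
  the carriers carry no meaning.\<close>

definition comm_square ::
  "'a graded_ring \<Rightarrow> ('a \<Rightarrow> 'b) \<Rightarrow> 'b graded_ring \<Rightarrow> ('a \<Rightarrow> 'c) \<Rightarrow> ('b \<Rightarrow> 'd) \<Rightarrow>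
   'c graded_ring \<Rightarrow> ('c \<Rightarrow> 'd) \<Rightarrow> 'd graded_ring \<Rightarrow> bool" where
  "comm_square A f B a b C g D \<longleftrightarrow>
     graded_cring A \<and> graded_cring B \<and> graded_cring C \<and> graded_cring D \<and>
     f \<in> graded_hom A B \<and> a \<in> graded_hom A C \<and>
     b \<in> graded_hom B D \<and> g \<in> graded_hom C D \<and>
     (\<forall>x\<in>carrier A. b (f x) = g (a x))"

text \<open>The inverse limit along \<open>\<pi> (j+1): A (j+1) \<rightarrow> A j\<close>, for \<open>j\<close> in an up-closed index set
  \<open>J\<close>: \<open>lim_piece J A \<pi> r\<close> is the inverse limit of the pieces of degree \<open>r\<close>, and the carrier
  of \<open>graded_lim J A \<pi>\<close> is the sum of the \<open>lim_piece J A \<pi> r\<close> over all \<open>r\<close>, formed inside the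
  compatible sequences. This sum is direct because it is so in each \<open>A j\<close>.\<close>

definition lim_piece ::
  "nat set \<Rightarrow> (nat \<Rightarrow> 'a graded_ring) \<Rightarrow> (nat \<Rightarrow> 'a \<Rightarrow> 'a) \<Rightarrow> nat \<Rightarrow> (nat \<Rightarrow> 'a) set" where
  "lim_piece J A \<pi> r = {f \<in> (\<Pi>\<^sub>E j\<in>J. piece (A j) r). \<forall>j\<in>J. \<pi> (j + 1) (f (j + 1)) = f j}"

definition graded_lim ::
  "nat set \<Rightarrow> (nat \<Rightarrow> 'a graded_ring) \<Rightarrow> (nat \<Rightarrow> 'a \<Rightarrow> 'a) \<Rightarrow> (nat \<Rightarrow> 'a) graded_ring" where
  "graded_lim J A \<pi> =
    \<lparr>carrier = {\<lambda>j\<in>J. \<Oplus>\<^bsub>A j\<^esub>r\<in>{..<N}. g r j | N g. \<forall>r<N. g r \<in> lim_piece J A \<pi> r},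
     monoid.mult = (\<lambda>f g. \<lambda>j\<in>J. f j \<otimes>\<^bsub>A j\<^esub> g j),
     one = (\<lambda>j\<in>J. \<one>\<^bsub>A j\<^esub>),
     zero = (\<lambda>j\<in>J. \<zero>\<^bsub>A j\<^esub>),
     add = (\<lambda>f g. \<lambda>j\<in>J. f j \<oplus>\<^bsub>A j\<^esub> g j),
     piece = lim_piece J A \<pi>\<rparr>"

section \<open>Polynomials and the rings \<open>\<Lambda>\<^bsub>m,k\<^esub>\<close>\<close>

text \<open>The pair \<open>(p, [\<mu>\<^sub>1, \<dots>, \<mu>\<^sub>d])\<close> stands for the indeterminate with indices \<open>p \<mu>\<^sub>1 \<dots> \<mu>\<^sub>d\<close>.\<close>

type_synonym indet = "nat \<times> nat list"
type_synonym mon = "indet \<Rightarrow>\<^sub>0 nat"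
type_synonym mpoly = "mon \<Rightarrow>\<^sub>0 int"

definition all_indets :: "nat \<Rightarrow> indet set" where
  "all_indets n = {(p, \<mu>). 1 \<le> p \<and> set \<mu> \<subseteq> {1..n}}"

definition indets :: "nat \<Rightarrow> nat \<Rightarrow> nat \<Rightarrow> indet set" where
  "indets n m k = {(p, \<mu>) \<in> all_indets n. p \<le> m \<and> length \<mu> \<le> k}"

definition mdeg :: "mon \<Rightarrow> nat" where
  "mdeg t = (\<Sum>x\<in>Poly_Mapping.keys t. Poly_Mapping.lookup t x)"

definition var :: "indet \<Rightarrow> mpoly" where
  "var x = Poly_Mapping.single (Poly_Mapping.single x 1) 1"

text \<open>Substitution of polynomials for the indeterminates; \<open>frag_extend\<close> is the
  \<open>\<int>\<close>-linear extension of a map given on the monomials.\<close>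

definition mpoly_subst :: "(indet \<Rightarrow> mpoly) \<Rightarrow> mpoly \<Rightarrow> mpoly" where
  "mpoly_subst s f = frag_extend (\<lambda>t. \<Prod>x\<in>Poly_Mapping.keys t. s x ^ Poly_Mapping.lookup t x) f"

definition set_zero :: "indet set \<Rightarrow> mpoly \<Rightarrow> mpoly" where
  "set_zero Z = mpoly_subst (\<lambda>x. if x \<in> Z then 0 else var x)"

definition sym_polys :: "indet set \<Rightarrow> mpoly set" where
  "sym_polys I = {f. (\<forall>t\<in>Poly_Mapping.keys f. Poly_Mapping.keys t \<subseteq> I) \<and>
                     (\<forall>\<sigma>. \<sigma> permutes I \<longrightarrow> mpoly_subst (\<lambda>x. var (\<sigma> x)) f = f)}"

definition Lam_mk :: "nat \<Rightarrow> nat \<Rightarrow> nat \<Rightarrow> mpoly graded_ring" where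
  "Lam_mk n m k =
    \<lparr>carrier = sym_polys (indets n m k), monoid.mult = (*), one = 1, zero = 0, add = (+),
     piece = (\<lambda>r. {f \<in> sym_polys (indets n m k). \<forall>t\<in>Poly_Mapping.keys f. mdeg t = r})\<rparr>"

text \<open>\<open>h_proj n m k: \<Lambda>\<^bsub>m,k\<^esub> \<rightarrow> \<Lambda>\<^bsub>m-1,k\<^esub>\<close> and \<open>v_proj n m k: \<Lambda>\<^bsub>m,k\<^esub> \<rightarrow> \<Lambda>\<^bsub>m,k-1\<^esub>\<close> are indexed by their sources.\<close>

definition h_proj :: "nat \<Rightarrow> nat \<Rightarrow> nat \<Rightarrow> mpoly \<Rightarrow> mpoly" where
  "h_proj n m k = set_zero {(p, \<mu>) \<in> indets n m k. p = m}"

definition v_proj :: "nat \<Rightarrow> nat \<Rightarrow> nat \<Rightarrow> mpoly \<Rightarrow> mpoly" where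
  "v_proj n m k = set_zero {(p, \<mu>) \<in> indets n m k. length \<mu> = k}"

text \<open>\<open>phi_k n m\<^sub>2 m\<^sub>1 k = h_proj n (m\<^sub>1+1) k \<circ> \<dots> \<circ> h_proj n m\<^sub>2 k\<close> and
  \<open>psi_m n m k\<^sub>2 k\<^sub>1 = v_proj n m (k\<^sub>1+1) \<circ> \<dots> \<circ> v_proj n m k\<^sub>2\<close>.\<close>

definition phi_k :: "nat \<Rightarrow> nat \<Rightarrow> nat \<Rightarrow> nat \<Rightarrow> mpoly \<Rightarrow> mpoly" where
  "phi_k n m2 m1 k = foldr (\<circ>) (map (\<lambda>m. h_proj n m k) [m1 + 1..<m2 + 1]) id"

definition psi_m :: "nat \<Rightarrow> nat \<Rightarrow> nat \<Rightarrow> nat \<Rightarrow> mpoly \<Rightarrow> mpoly" where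
  "psi_m n m k2 k1 = foldr (\<circ>) (map (\<lambda>k. v_proj n m k) [k1 + 1..<k2 + 1]) id"

section \<open>The limits in one direction\<close>

definition Lam_k :: "nat \<Rightarrow> nat \<Rightarrow> (nat \<Rightarrow> mpoly) graded_ring" where
  "Lam_k n k = graded_lim {1..} (\<lambda>m. Lam_mk n m k) (\<lambda>m. h_proj n m k)"

definition Lam_m :: "nat \<Rightarrow> nat \<Rightarrow> (nat \<Rightarrow> mpoly) graded_ring" where
  "Lam_m n m = graded_lim {0..} (\<lambda>k. Lam_mk n m k) (\<lambda>k. v_proj n m k)"

text \<open>\<open>H_mk m k: \<Lambda>\<^bsub>\<cdot>,k\<^esub> \<rightarrow> \<Lambda>\<^bsub>m,k\<^esub>\<close> and \<open>V_mk m k: \<Lambda>\<^bsub>m,\<cdot>\<^esub> \<rightarrow> \<Lambda>\<^bsub>m,k\<^esub>\<close> pick a term of a compatible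
  sequence, which is indexed by \<open>m\<close> in the first case and by \<open>k\<close> in the second.\<close>

definition H_mk :: "nat \<Rightarrow> nat \<Rightarrow> (nat \<Rightarrow> mpoly) \<Rightarrow> mpoly" where
  "H_mk m k f = f m"

definition V_mk :: "nat \<Rightarrow> nat \<Rightarrow> (nat \<Rightarrow> mpoly) \<Rightarrow> mpoly" where
  "V_mk m k f = f k"

definition phi :: "nat \<Rightarrow> nat \<Rightarrow> nat \<Rightarrow> (nat \<Rightarrow> mpoly) \<Rightarrow> (nat \<Rightarrow> mpoly)" where
  "phi n m2 m1 f = (\<lambda>k\<in>{0..}. phi_k n m2 m1 k (f k))"

definition psi :: "nat \<Rightarrow> nat \<Rightarrow> nat \<Rightarrow> (nat \<Rightarrow> mpoly) \<Rightarrow> (nat \<Rightarrow> mpoly)" where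
  "psi n k2 k1 f = (\<lambda>m\<in>{1..}. psi_m n m k2 k1 (f m))"

section \<open>Symmetric functions in all indeterminates\<close>

text \<open>A symmetric function is a formal sum of monomials, of bounded degree, invariant under
  the permutations of the indeterminates. It is represented by its coefficients.
  The monomial \<open>map_key \<sigma> t\<close> is \<open>t\<close> with the indeterminates renamed by the inverse of \<open>\<sigma>\<close>.\<close>

type_synonym series = "mon \<Rightarrow> int"

definition sym_series :: "indet set \<Rightarrow> series set" where
  "sym_series I = {c. (\<forall>t. c t \<noteq> 0 \<longrightarrow> Poly_Mapping.keys t \<subseteq> I) \<and>
                      (\<exists>N. \<forall>t. c t \<noteq> 0 \<longrightarrow> mdeg t \<le> N) \<and>
                      (\<forall>\<sigma>. \<sigma> permutes I \<longrightarrow> (\<forall>t. c (Poly_Mapping.map_key \<sigma> t) = c t))}"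

definition Lam :: "nat \<Rightarrow> series graded_ring" where
  "Lam n =
    \<lparr>carrier = sym_series (all_indets n),
     monoid.mult = (\<lambda>c d t. \<Sum>(u, w) | u + w = t. c u * d w),
     one = (\<lambda>t. if t = 0 then 1 else 0),
     zero = (\<lambda>t. 0),
     add = (\<lambda>c d t. c t + d t),
     piece = (\<lambda>r. {c \<in> sym_series (all_indets n). \<forall>t. c t \<noteq> 0 \<longrightarrow> mdeg t = r})\<rparr>"

definition set_zero_series :: "indet set \<Rightarrow> series \<Rightarrow> series" where
  "set_zero_series Z c = (\<lambda>t. if Poly_Mapping.keys t \<inter> Z = {} then c t else 0)"

text \<open>Setting to zero all indeterminates with \<open>p > m\<close> leaves a symmetric function in those with
  \<open>p \<le> m\<close>. As an element of \<open>\<Lambda>\<^bsub>m,\<cdot>\<^esub>\<close> this is the compatible sequence whose \<open>k\<close>-th term is the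
  polynomial that remains when all indeterminates with \<open>d > k\<close> are set to zero as well; and
  conversely for \<open>V_proj\<close>. \<open>Abs_poly_mapping\<close> turns a series with finitely many nonzero
  coefficients into a polynomial.\<close>

definition H_proj :: "nat \<Rightarrow> series \<Rightarrow> (nat \<Rightarrow> mpoly)" where
  "H_proj m c = (\<lambda>k\<in>{0..}. Abs_poly_mapping
     (set_zero_series {(p, \<mu>). length \<mu> > k} (set_zero_series {(p, \<mu>). p > m} c)))"

definition V_proj :: "nat \<Rightarrow> series \<Rightarrow> (nat \<Rightarrow> mpoly)" where
  "V_proj k c = (\<lambda>m\<in>{1..}. Abs_poly_mapping
     (set_zero_series {(p, \<mu>). p > m} (set_zero_series {(p, \<mu>). length \<mu> > k} c)))"

end

theory Submission
  imports Defs
begin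

text \<open>On coefficients, every arrow of the diagram keeps the coefficients of the monomials that avoid
  a certain set of indeterminates and discards the others. Such truncations are homomorphisms, they
  commute with each other, and they preserve symmetry because a permutation of the remaining
  indeterminates extends by the identity. The limits enter only through their universal property
  among graded rings, which produces the arrows into them from the truncations at each level.\<close>

text \<open>Commutativity is the small part: \<open>comm_square\<close> also asks that the four
  corners be graded rings with unique decompositions and that the four arrows be graded
  homomorphisms. Two differences of representation shape the work. Symmetry of polynomials is stated
  by substituting variables, symmetry of series by renaming monomials; \<open>lookup\<close> is
  injective and translates one into the other, so polynomial statements are pulled back from those
  for series. In the other direction \<open>Abs_poly_mapping\<close> is meaningful only on finite
  support, which holds because a bounded degree leaves finitely many monomials in finitely many
  indeterminates. The limit is the sum of the degreewise limits, not the set of all compatible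
  sequences, so membership means exhibiting homogeneous components with one degree bound valid at
  every index. Finally, \<open>h_proj\<close> and \<open>v_proj\<close> zero sets that depend on
  their source; on its carrier they agree with truncations by \<open>above m\<close> or
  \<open>longer k\<close>, and a composite of these is governed by the union of the sets.\<close>

abbreviation (input) lookup :: "('a \<Rightarrow>\<^sub>0 'b::zero) \<Rightarrow> 'a \<Rightarrow> 'b" where
  "lookup \<equiv> Poly_Mapping.lookup"

abbreviation (input) keys :: "('a \<Rightarrow>\<^sub>0 'b::zero) \<Rightarrow> 'a set" where
  "keys \<equiv> Poly_Mapping.keys"

abbreviation (input) map_key :: "('a \<Rightarrow> 'b) \<Rightarrow> ('b \<Rightarrow>\<^sub>0 'c::zero) \<Rightarrow> 'a \<Rightarrow>\<^sub>0 'c" where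
  "map_key \<equiv> Poly_Mapping.map_key"

section \<open>Monomials\<close>

lemma keys_plus_nat: "keys (u + w) = keys u \<union> keys (w :: 'a \<Rightarrow>\<^sub>0 nat)"
  by (auto simp: in_keys_iff lookup_add)

text \<open>\<open>lookup\<close> embeds these mappings into the functions that vanish off
  \<open>I\<close> and take values in \<open>{..N}\<close>, of which there are finitely
  many.\<close>

lemma finite_bounded_poly_mapping:
  assumes "finite I"
  shows "finite {t :: 'a \<Rightarrow>\<^sub>0 nat. keys t \<subseteq> I \<and> (\<forall>x. lookup t x \<le> N)}"
proof -
  have "lookup ` {t :: 'a \<Rightarrow>\<^sub>0 nat. keys t \<subseteq> I \<and> (\<forall>x. lookup t x \<le> N)}
      \<subseteq> {f. \<forall>x. (x \<in> I \<longrightarrow> f x \<in> {..N}) \<and> (x \<notin> I \<longrightarrow> f x = 0)}"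
    by (auto simp: in_keys_iff subset_iff)
  moreover have "finite {f. \<forall>x. (x \<in> I \<longrightarrow> f x \<in> {..N}) \<and> (x \<notin> I \<longrightarrow> f x = (0::nat))}"
    using assms by (intro finite_set_of_finite_funs) auto
  ultimately have "finite (lookup ` {t :: 'a \<Rightarrow>\<^sub>0 nat. keys t \<subseteq> I \<and> (\<forall>x. lookup t x \<le> N)})"
    by (rule finite_subset)
  then show ?thesis
    by (rule finite_imageD) (auto simp: inj_on_def poly_mapping_eqI)
qed

text \<open>Lets degrees of monomials with different supports be compared over one common index
  set.\<close>

lemma mdeg_superset: "finite K \<Longrightarrow> keys t \<subseteq> K \<Longrightarrow> mdeg t = (\<Sum>x\<in>K. lookup t x)"
  unfolding mdeg_def by (rule sum.mono_neutral_left) (auto simp: in_keys_iff)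

lemma lookup_le_mdeg: "lookup t x \<le> mdeg t"
  unfolding mdeg_def by (cases "x \<in> keys t") (simp_all add: member_le_sum not_in_keys_iff_lookup_eq_zero)

lemma mdeg_zero [simp]: "mdeg 0 = 0"
  by (simp add: mdeg_def)

lemma mdeg_plus: "mdeg (u + w) = mdeg u + mdeg w"
  using mdeg_superset[of "keys u \<union> keys w" "u + w"] mdeg_superset[of "keys u \<union> keys w" u]
    mdeg_superset[of "keys u \<union> keys w" w]
  by (simp add: keys_plus_nat lookup_add sum.distrib)

lemma mdeg_map_key:
  assumes "bij \<sigma>"
  shows "mdeg (map_key \<sigma> t) = mdeg t"
proof -
  have "(\<Sum>x\<in>\<sigma> -` keys t. lookup t (\<sigma> x)) = (\<Sum>y\<in>keys t. lookup t y)"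
    using assms by (intro sum.reindex_bij_betw bij_betw_imageI)
      (auto simp: bij_def inj_on_def surj_image_vimage_eq)
  then show ?thesis
    using assms by (simp add: mdeg_def keys_map_key map_key.rep_eq bij_is_inj)
qed

lemma map_key_inv [simp]:
  assumes "bij \<sigma>"
  shows "map_key \<sigma> (map_key (inv_into UNIV \<sigma>) t) = t" "map_key (inv_into UNIV \<sigma>) (map_key \<sigma> t) = t"
  using assms
  by (auto intro!: poly_mapping_eqI simp: map_key.rep_eq bij_is_inj bij_imp_bij_inv bij_is_surj surj_f_inv_f)

lemma finite_mon_bounded_mdeg: "finite I \<Longrightarrow> finite {t. keys t \<subseteq> I \<and> mdeg t \<le> N}"
  by (rule finite_subset[OF _ finite_bounded_poly_mapping[of I N]])
     (auto intro: order_trans[OF lookup_le_mdeg])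

text \<open>Although there are infinitely many indeterminates, a divisor of \<open>t\<close> uses
  only those of \<open>t\<close> and has at most its degree. Hence the sums that define the product
  in \<open>Lam\<close> are genuine finite sums and not the default value 0.\<close>

lemma finite_splittings: "finite {(u, w). u + w = (t :: mon)}"
proof -
  have "{(u, w). u + w = t} \<subseteq> {u. keys u \<subseteq> keys t \<and> mdeg u \<le> mdeg t} \<times> {u. keys u \<subseteq> keys t \<and> mdeg u \<le> mdeg t}"
    by (auto simp: keys_plus_nat mdeg_plus)
  then show ?thesis
    by (rule finite_subset) (intro finite_cartesian_product finite_mon_bounded_mdeg finite_keys)
qed

section \<open>Convolution of coefficient functions\<close>

text \<open>The multiplication of \<open>Lam\<close>, isolated because it also describes products of
  polynomials (\<open>lookup_times\<close>).\<close>

definition conv :: "series \<Rightarrow> series \<Rightarrow> series" where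
  "conv c d = (\<lambda>t. \<Sum>(u, w) | u + w = t. c u * d w)"

lemma conv_nonzeroE:
  assumes "conv c d t \<noteq> 0"
  obtains u w where "t = u + w" "c u \<noteq> 0" "d w \<noteq> 0"
  using assms unfolding conv_def by (force elim!: sum.not_neutral_contains_not_neutral)

lemma conv_commute: "conv c d = conv d c"
  unfolding conv_def
  by (rule ext, rule sum.reindex_bij_witness[where i = prod.swap and j = prod.swap])
     (auto simp: add.commute)

text \<open>Both iterated sums run over the factorisations of \<open>t\<close> into three monomials;
  the two \<open>SIGMA\<close> sets record the two bracketings.\<close>

lemma conv_assoc: "conv (conv c d) e = conv c (conv d e)"
proof
  fix t
  have "conv (conv c d) e t =
      (\<Sum>((u, w), (a, b))\<in>(SIGMA (u, w):{(u, w). u + w = t}. {(a, b). a + b = u}). c a * d b * e w)"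
    unfolding conv_def
    by (simp add: sum_distrib_right split_def)
       (subst sum.Sigma, auto simp: finite_splittings[unfolded split_def] split_def)
  also have "\<dots> = (\<Sum>((a, v), (b, w))\<in>(SIGMA (a, v):{(u, w). u + w = t}. {(b, w). b + w = v}). c a * (d b * e w))"
    \<comment> \<open>The bijection rebrackets \<open>(a + b) + w\<close> as
      \<open>a + (b + w)\<close>.\<close>
    by (rule sum.reindex_bij_witness[where
          i = "\<lambda>((a, v), (b, w)). ((a + b, w), (a, b))" and j = "\<lambda>((u, w), (a, b)). ((a, b + w), (b, w))"])
       (auto simp: add_ac mult_ac)
  also have "\<dots> = conv c (conv d e) t"
    unfolding conv_def
    by (simp add: sum_distrib_left split_def)
       (subst sum.Sigma, auto simp: finite_splittings[unfolded split_def] split_def)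
  finally show "conv (conv c d) e t = conv c (conv d e) t" .
qed

lemma conv_add_left: "conv (\<lambda>t. c t + d t) e = (\<lambda>t. conv c e t + conv d e t)"
  by (auto simp: conv_def split_def distrib_right sum.distrib)

lemma conv_one_left: "conv (\<lambda>t. if t = 0 then 1 else 0) c = c"
proof
  fix t
  \<comment> \<open>Only the splitting \<open>(0, t)\<close> can contribute.\<close>
  have "conv (\<lambda>t. if t = 0 then 1 else 0) c t = (\<Sum>(u, w)\<in>{(0 :: mon, t)}. (if u = 0 then 1 else 0) * c w)"
    unfolding conv_def by (rule sum.mono_neutral_right) (auto simp: finite_splittings split: if_splits)
  then show "conv (\<lambda>t. if t = 0 then 1 else 0) c t = c t" by simp
qed

text \<open>Renaming is additive and invertible on monomials, so it matches the splittings of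
  \<open>t\<close> with those of \<open>map_key \<sigma> t\<close>.\<close>

lemma conv_map_key:
  assumes "bij \<sigma>" "\<And>t. c (map_key \<sigma> t) = c t" "\<And>t. d (map_key \<sigma> t) = d t"
  shows "conv c d (map_key \<sigma> t) = conv c d t"
  unfolding conv_def
  by (rule sum.reindex_bij_witness[where i = "\<lambda>(u, w). (map_key \<sigma> u, map_key \<sigma> w)"
        and j = "\<lambda>(u, w). (map_key (inv_into UNIV \<sigma>) u, map_key (inv_into UNIV \<sigma>) w)"])
     (use assms(1) in \<open>auto simp: assms(2,3) bij_is_inj bij_imp_bij_inv simp flip: map_key_plus\<close>,
      (metis assms map_key_inv(1))+)

lemma lookup_times: "lookup (f * g) = conv (lookup f) (lookup g)" for f g :: mpoly
proof
  fix t
  have "lookup (f * g) t = (\<Sum>(a, b). lookup f a * lookup g b when t = a + b)"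
    by (simp add: times_poly_mapping.rep_eq prod_fun_unfold_prod)
  \<comment> \<open>The \<open>when\<close> kills every pair that is not a splitting of
    \<open>t\<close>, so the sum over all pairs shrinks to a finite set.\<close>
  also have "\<dots> = (\<Sum>(a, b) | a + b = t. lookup f a * lookup g b when t = a + b)"
    using finite_splittings[of t] by (intro Sum_any.expand_superset) auto
  also have "\<dots> = conv (lookup f) (lookup g) t"
    unfolding conv_def by (rule sum.cong) auto
  finally show "lookup (f * g) t = conv (lookup f) (lookup g) t" .
qed

text \<open>Exponents are natural numbers and cannot cancel, so a product of monomials avoids
  \<open>Z\<close> exactly when both factors do.\<close>

lemma set_zero_series_conv:
  "set_zero_series Z (conv c d) = conv (set_zero_series Z c) (set_zero_series Z d)"
proof
  fix t
  show "set_zero_series Z (conv c d) t = conv (set_zero_series Z c) (set_zero_series Z d) t"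
  proof (cases "keys t \<inter> Z = {}")
    case True
    then show ?thesis
      unfolding conv_def set_zero_series_def
      by (auto intro!: sum.cong simp: keys_plus_nat Int_Un_distrib2)
  next
    case False
    then have "conv (set_zero_series Z c) (set_zero_series Z d) t = 0"
      unfolding conv_def set_zero_series_def
      by (intro sum.neutral) (auto simp: keys_plus_nat)
    with False show ?thesis
      by (simp add: set_zero_series_def)
  qed
qed

section \<open>Substitutions\<close>

lemma prod_single:
  fixes a :: "'b \<Rightarrow> mon"
  shows "finite A \<Longrightarrow> (\<Prod>x\<in>A. Poly_Mapping.single (a x) (1::int)) = Poly_Mapping.single (\<Sum>x\<in>A. a x) 1"
  by (induction A rule: finite_induct) (simp_all add: mult_single)

lemma var_power: "var x ^ e = Poly_Mapping.single (Poly_Mapping.single x e) 1"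
  by (induction e) (simp_all add: var_def mult_single flip: single_add)

lemma sum_single_lookup: "(\<Sum>x\<in>keys t. Poly_Mapping.single x (lookup t x)) = t" for t :: mon
proof (rule poly_mapping_eqI)
  fix y
  have "(\<Sum>x\<in>keys t. lookup (Poly_Mapping.single x (lookup t x)) y) = (\<Sum>x\<in>keys t. if x = y then lookup t x else 0)"
    by (rule sum.cong) (auto simp: lookup_single)
  then show "lookup (\<Sum>x\<in>keys t. Poly_Mapping.single x (lookup t x)) y = lookup t y"
    by (simp add: lookup_sum in_keys_iff)
qed

text \<open>Moving the exponent at \<open>x\<close> to \<open>\<sigma> x\<close> means reading off
  the exponent of \<open>y\<close> at the preimage of \<open>y\<close>; hence the inverse on the
  right.\<close>

lemma sum_single_permute:
  fixes t :: mon
  assumes "bij \<sigma>"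
  shows "(\<Sum>x\<in>keys t. Poly_Mapping.single (\<sigma> x) (lookup t x)) = map_key (inv_into UNIV \<sigma>) t"
proof (rule poly_mapping_eqI)
  fix y
  have "(\<Sum>x\<in>keys t. lookup (Poly_Mapping.single (\<sigma> x) (lookup t x)) y)
      = (\<Sum>x\<in>keys t. if x = inv_into UNIV \<sigma> y then lookup t x else 0)"
    using assms by (intro sum.cong) (auto simp: lookup_single when_def bij_is_inj bij_is_surj surj_f_inv_f)
  then show "lookup (\<Sum>x\<in>keys t. Poly_Mapping.single (\<sigma> x) (lookup t x)) y = lookup (map_key (inv_into UNIV \<sigma>) t) y"
    using assms
    by (simp add: lookup_sum in_keys_iff map_key.rep_eq bij_is_inj bij_imp_bij_inv)
qed

lemma lookup_mpoly_subst:
  "lookup (mpoly_subst s f) t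
     = (\<Sum>u\<in>keys f. lookup f u * lookup (\<Prod>x\<in>keys u. s x ^ lookup u x) t)"
  by (simp add: mpoly_subst_def frag_extend_def lookup_sum)

text \<open>Identifies the substitution in \<open>set_zero\<close> with truncation of coefficients:
  a monomial that meets \<open>Z\<close> becomes 0, any other is reproduced.\<close>

lemma lookup_set_zero: "lookup (set_zero Z f) = set_zero_series Z (lookup f)"
proof
  fix t
  have *: "(\<Prod>x\<in>keys u. (if x \<in> Z then 0 else var x) ^ lookup u x)
      = (if keys u \<inter> Z = {} then Poly_Mapping.single u 1 else 0)" for u :: mon
  proof (cases "keys u \<inter> Z = {}")
    case True
    then have "(\<Prod>x\<in>keys u. (if x \<in> Z then 0 else var x) ^ lookup u x) = (\<Prod>x\<in>keys u. var x ^ lookup u x)"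
      by (intro prod.cong) auto
    with True show ?thesis by (simp add: var_power prod_single sum_single_lookup)
  next
    case False
    then obtain x where x: "x \<in> keys u" "x \<in> Z" by blast
    then have "(\<Prod>x\<in>keys u. (if x \<in> Z then 0 else var x) ^ lookup u x) = 0"
      \<comment> \<open>The exponent of a key is nonzero; this matters because \<open>0 ^ 0\<close>
        would be 1.\<close>
      by (intro prod_zero bexI[of _ x]) (auto simp: in_keys_iff zero_power)
    with False show ?thesis by simp
  qed
  have "lookup (set_zero Z f) t = (\<Sum>u\<in>keys f. if u = t then set_zero_series Z (lookup f) t else 0)"
    unfolding set_zero_def lookup_mpoly_subst *
    by (rule sum.cong) (auto simp: lookup_single set_zero_series_def)
  then show "lookup (set_zero Z f) t = set_zero_series Z (lookup f) t"
    by (simp add: in_keys_iff set_zero_series_def)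
qed

text \<open>The monomial \<open>u\<close> is sent to its renaming by \<open>\<sigma>\<close>, so the
  coefficient at \<open>t\<close> comes from \<open>u = map_key \<sigma> t\<close> alone. This links
  the symmetry condition of \<open>sym_polys\<close> with that of \<open>sym_series\<close>.\<close>

lemma lookup_permute_vars:
  assumes "bij \<sigma>"
  shows "lookup (mpoly_subst (\<lambda>x. var (\<sigma> x)) f) t = lookup f (map_key \<sigma> t)"
proof -
  have "lookup (mpoly_subst (\<lambda>x. var (\<sigma> x)) f) t
      = (\<Sum>u\<in>keys f. if u = map_key \<sigma> t then lookup f u else 0)"
    unfolding lookup_mpoly_subst var_power using assms
    by (intro sum.cong) (auto simp: prod_single sum_single_permute lookup_single when_def)
  then show ?thesis
    by (simp add: in_keys_iff)
qed

section \<open>Symmetric series and symmetric polynomials\<close>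

lemma sym_seriesI:
  assumes "\<And>t. c t \<noteq> 0 \<Longrightarrow> keys t \<subseteq> I" "\<And>t. c t \<noteq> 0 \<Longrightarrow> mdeg t \<le> N"
    "\<And>\<sigma> t. \<sigma> permutes I \<Longrightarrow> c (map_key \<sigma> t) = c t"
  shows "c \<in> sym_series I"
  using assms unfolding sym_series_def by blast

lemma sym_seriesE:
  assumes "c \<in> sym_series I"
  obtains N where "\<And>t. c t \<noteq> 0 \<Longrightarrow> mdeg t \<le> N"
  using assms unfolding sym_series_def by blast

lemma sym_series_keys: "c \<in> sym_series I \<Longrightarrow> c t \<noteq> 0 \<Longrightarrow> keys t \<subseteq> I"
  unfolding sym_series_def by blast

lemma sym_series_map_key: "c \<in> sym_series I \<Longrightarrow> \<sigma> permutes I \<Longrightarrow> c (map_key \<sigma> t) = c t"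
  unfolding sym_series_def by blast

lemma sym_series_zero: "(\<lambda>t. 0) \<in> sym_series I"
  by (rule sym_seriesI) auto

lemma sym_series_one: "(\<lambda>t. if t = 0 then 1 else 0) \<in> sym_series I"
proof (rule sym_seriesI)
  fix \<sigma> :: "indet \<Rightarrow> indet" and t :: mon
  assume "\<sigma> permutes I"
  then have "bij \<sigma>" by (rule permutes_bij)
  \<comment> \<open>Renaming has an inverse that also fixes the monomial 0, so nothing else is sent
    to 0.\<close>
  then have "map_key \<sigma> t = 0 \<longleftrightarrow> t = 0"
    by (metis map_key_inv(2) bij_is_inj bij_imp_bij_inv map_key_zero)
  then show "(if map_key \<sigma> t = 0 then 1 else 0) = (if t = 0 then 1 else (0::int))" by simp
qed (auto split: if_splits)

lemma sym_series_add:
  assumes "c \<in> sym_series I" "d \<in> sym_series I"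
  shows "(\<lambda>t. c t + d t) \<in> sym_series I"
proof -
  obtain M N where "\<And>t. c t \<noteq> 0 \<Longrightarrow> mdeg t \<le> M" "\<And>t. d t \<noteq> 0 \<Longrightarrow> mdeg t \<le> N"
    using assms by (metis sym_seriesE)
  then have "mdeg t \<le> max M N" if "c t + d t \<noteq> 0" for t
    using that by (metis add.right_neutral le_max_iff_disj)
  then show ?thesis
    using assms by (intro sym_seriesI) (auto simp: sym_series_map_key dest: sym_series_keys, metis add.right_neutral subsetD sym_series_keys)
qed

lemma sym_series_uminus: "c \<in> sym_series I \<Longrightarrow> (\<lambda>t. - c t) \<in> sym_series I"
  unfolding sym_series_def by simp

lemma sym_series_conv:
  assumes "c \<in> sym_series I" "d \<in> sym_series I"
  shows "conv c d \<in> sym_series I"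
proof -
  obtain M N where *: "\<And>t. c t \<noteq> 0 \<Longrightarrow> mdeg t \<le> M" "\<And>t. d t \<noteq> 0 \<Longrightarrow> mdeg t \<le> N"
    using assms by (metis sym_seriesE)
  show ?thesis
  proof (rule sym_seriesI)
    fix t assume "conv c d t \<noteq> 0"
    then obtain u w where uw: "t = u + w" "c u \<noteq> 0" "d w \<noteq> 0" by (rule conv_nonzeroE)
    then show "keys t \<subseteq> I" "mdeg t \<le> M + N"
      using * assms by (simp_all add: keys_plus_nat sym_series_keys mdeg_plus add_mono)
  next
    fix \<sigma> t assume "\<sigma> permutes I"
    then show "conv c d (map_key \<sigma> t) = conv c d t"
      using assms by (intro conv_map_key) (auto simp: sym_series_map_key permutes_bij)
  qed
qed

text \<open>Renaming preserves degrees, so homogeneous components of a symmetric series are again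
  symmetric.\<close>

lemma sym_series_restrict_mdeg:
  assumes "c \<in> sym_series I"
  shows "(\<lambda>t. if mdeg t = r then c t else 0) \<in> sym_series I"
  using assms
  by (intro sym_seriesI[where N = r])
     (auto simp: sym_series_map_key mdeg_map_key permutes_bij split: if_splits dest: sym_series_keys)

lemma sym_series_set_zero:
  assumes "c \<in> sym_series I"
  shows "set_zero_series Z c \<in> sym_series (I - Z)"
proof -
  obtain N where N: "\<And>t. c t \<noteq> 0 \<Longrightarrow> mdeg t \<le> N"
    using assms by (metis sym_seriesE)
  show ?thesis
  proof (rule sym_seriesI)
    fix t assume "set_zero_series Z c t \<noteq> 0"
    then have "c t \<noteq> 0" "keys t \<inter> Z = {}" by (auto simp: set_zero_series_def split: if_splits)
    then show "keys t \<subseteq> I - Z" "mdeg t \<le> N"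
      using N sym_series_keys[OF assms] by auto
  next
    fix \<sigma> t assume \<sigma>: "\<sigma> permutes I - Z"
    then have "\<sigma> permutes I" by (rule permutes_subset) auto
    then have c: "c (map_key \<sigma> t) = c t" and keys: "keys (map_key \<sigma> t) = \<sigma> -` keys t"
      using assms by (auto simp: sym_series_map_key keys_map_key permutes_inj)
    show "set_zero_series Z c (map_key \<sigma> t) = set_zero_series Z c t"
    proof (cases "c t = 0")
      case False
      \<comment> \<open>Points of \<open>Z\<close> outside \<open>I\<close> are fixed too, so
        renaming does not change which elements of \<open>Z\<close> occur in the monomial.\<close>
      have "\<sigma> x = x" if "x \<in> Z" for x
        using \<sigma> that by (metis Diff_iff permutes_not_in)
      then have "keys (map_key \<sigma> t) \<inter> Z = keys t \<inter> Z"
        unfolding keys by auto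
      with c show ?thesis by (simp add: set_zero_series_def)
    qed (simp add: set_zero_series_def c)
  qed
qed

text \<open>The bounded degree demanded of a series is automatic for a polynomial: take the maximum
  over its finitely many monomials. Through this equivalence closure properties pass from series to
  polynomials.\<close>

lemma lookup_in_sym_series_iff: "lookup f \<in> sym_series I \<longleftrightarrow> f \<in> sym_polys I"
proof -
  have "mdeg t \<le> Max (mdeg ` keys f)" if "lookup f t \<noteq> 0" for t
    using that by (intro Max_ge) (auto simp: in_keys_iff)
  then have "\<exists>N. \<forall>t. lookup f t \<noteq> 0 \<longrightarrow> mdeg t \<le> N" by blast
  moreover have "mpoly_subst (\<lambda>x. var (\<sigma> x)) f = f \<longleftrightarrow> (\<forall>t. lookup f (map_key \<sigma> t) = lookup f t)"
    if "\<sigma> permutes I" for \<sigma>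
    using lookup_permute_vars[OF permutes_bij[OF that], of f]
    by (metis poly_mapping_eqI)
  ultimately show ?thesis
    unfolding sym_series_def sym_polys_def by (auto simp: in_keys_iff)
qed

lemma finite_support_sym_series:
  assumes "finite I" "c \<in> sym_series I"
  shows "finite {t. c t \<noteq> 0}"
proof -
  obtain N where "\<And>t. c t \<noteq> 0 \<Longrightarrow> mdeg t \<le> N"
    using assms by (metis sym_seriesE)
  then have "{t. c t \<noteq> 0} \<subseteq> {t. keys t \<subseteq> I \<and> mdeg t \<le> N}"
    using sym_series_keys[OF assms(2)] by auto
  then show ?thesis
    by (rule finite_subset) (rule finite_mon_bounded_mdeg[OF assms(1)])
qed

text \<open>A symmetric series in finitely many indeterminates is a polynomial, because its degree
  is bounded; so \<open>Abs_poly_mapping\<close> loses nothing here.\<close>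

lemma lookup_Abs_sym_series:
  "finite I \<Longrightarrow> c \<in> sym_series I \<Longrightarrow> lookup (Abs_poly_mapping c) = c"
  by (simp add: finite_support_sym_series)

section \<open>Graded rings and their limits\<close>

text \<open>Turns an abstract \<open>finsum\<close> into an ordinary sum; \<open>h\<close> will be
  evaluation of coefficients at a fixed monomial.\<close>

lemma (in abelian_monoid) additive_finsum:
  assumes "h \<zero> = 0" "\<And>x y. x \<in> carrier G \<Longrightarrow> y \<in> carrier G \<Longrightarrow> h (x \<oplus> y) = h x + (h y :: 'c :: comm_monoid_add)"
    and "finite F" "\<And>i. i \<in> F \<Longrightarrow> g i \<in> carrier G"
  shows "h (\<Oplus>i\<in>F. g i) = (\<Sum>i\<in>F. h (g i))"
  using assms(3,4)
proof (induction F rule: finite_induct)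
  case (insert i F)
  then have "g \<in> F \<rightarrow> carrier G" by auto
  with insert show ?case by (simp add: assms(2))
qed (simp add: assms(1))

lemma (in abelian_monoid) finsum_superset:
  assumes "finite F" "S \<subseteq> F" "\<And>i. i \<in> F - S \<Longrightarrow> c i = \<zero>" "\<And>i. i \<in> S \<Longrightarrow> c i \<in> carrier G"
  shows "(\<Oplus>i\<in>S. c i) = (\<Oplus>i\<in>F. c i)"
proof (rule add.finprod_mono_neutral_cong_left)
  show "c \<in> F \<rightarrow> carrier G"
  proof
    show "c i \<in> carrier G" if "i \<in> F" for i
      using assms(3,4)[of i] that by (cases "i \<in> S") auto
  qed
qed (use assms in auto)

text \<open>Replaces unique existence over finitely supported families by sums over initial segments
  of degrees: every element is such a sum, and only zero components sum to zero. Uniqueness follows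
  by applying the second condition to the difference of two decompositions.\<close>

lemma graded_cringI:
  fixes R (structure)
  assumes "cring R"
    and piece: "\<And>r. subgroup (piece R r) (add_monoid R)"
    and "\<one> \<in> piece R 0"
    and "\<And>x y r s. \<lbrakk>x \<in> piece R r; y \<in> piece R s\<rbrakk> \<Longrightarrow> x \<otimes> y \<in> piece R (r + s)"
    and decomp: "\<And>x. x \<in> carrier R \<Longrightarrow> \<exists>N g. (\<forall>r. g r \<in> piece R r) \<and> x = (\<Oplus>r\<in>{..<N::nat}. g r)"
    and indep: "\<And>g N r. \<lbrakk>\<And>r. g r \<in> piece R r; (\<Oplus>r\<in>{..<N::nat}. g r) = \<zero>; r < N\<rbrakk> \<Longrightarrow> g r = \<zero>"
  shows "graded_cring R"
proof -
  interpret cring R by fact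
  have minus: "x \<ominus> y \<in> piece R r" if "x \<in> piece R r" "y \<in> piece R r" for r x y
    using subgroup.m_closed[OF piece[of r], of x "\<ominus> y"] subgroup.m_inv_closed[OF piece[of r], of y] that
    by (simp add: a_minus_def a_inv_def)
  have sub: "piece R r \<subseteq> carrier R" and zero: "\<zero> \<in> piece R r" for r
    using subgroup.subset[OF piece[of r]] subgroup.one_closed[OF piece[of r]] by auto
  have ex1: "\<exists>!c. (\<forall>r. c r \<in> piece R r) \<and> finite {r. c r \<noteq> \<zero>} \<and> x = (\<Oplus>r\<in>{r. c r \<noteq> \<zero>}. c r)"
    if "x \<in> carrier R" for x
  proof (rule ex_ex1I)
    obtain N g where g: "\<And>r. g r \<in> piece R r" "x = (\<Oplus>r\<in>{..<N::nat}. g r)"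
      using decomp[OF \<open>x \<in> carrier R\<close>] by blast
    \<comment> \<open>The values of \<open>g\<close> from \<open>N\<close> on are arbitrary, whereas
      a decomposition must have finite support.\<close>
    define c where "c = (\<lambda>r. if r < N then g r else \<zero>)"
    have c: "c r \<in> piece R r" for r
      using g zero by (simp add: c_def)
    have "{r. c r \<noteq> \<zero>} \<subseteq> {..<N}"
      by (auto simp: c_def split: if_splits)
    moreover from this have "finite {r. c r \<noteq> \<zero>}"
      by (rule finite_subset) simp
    moreover have "(\<Oplus>r\<in>{r. c r \<noteq> \<zero>}. c r) = (\<Oplus>r\<in>{..<N}. c r)"
      using calculation c sub by (intro finsum_superset) auto
    moreover have "(\<Oplus>r\<in>{..<N}. c r) = (\<Oplus>r\<in>{..<N}. g r)"
      using g(1) sub by (intro finsum_cong') (auto simp: c_def)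
    ultimately show "\<exists>c. (\<forall>r. c r \<in> piece R r) \<and> finite {r. c r \<noteq> \<zero>} \<and> x = (\<Oplus>r\<in>{r. c r \<noteq> \<zero>}. c r)"
      using c g(2) by (intro exI[of _ c]) simp
  next
    fix c c'
    assume c: "(\<forall>r. c r \<in> piece R r) \<and> finite {r. c r \<noteq> \<zero>} \<and> x = (\<Oplus>r\<in>{r. c r \<noteq> \<zero>}. c r)"
      and c': "(\<forall>r. c' r \<in> piece R r) \<and> finite {r. c' r \<noteq> \<zero>} \<and> x = (\<Oplus>r\<in>{r. c' r \<noteq> \<zero>}. c' r)"
    then have carr: "c r \<in> carrier R" "c' r \<in> carrier R" for r
      using sub by auto
    \<comment> \<open>One bound for both supports lets the two sums be subtracted term by
      term.\<close>
    obtain N where N: "{r. c r \<noteq> \<zero>} \<union> {r. c' r \<noteq> \<zero>} \<subseteq> {..<N}"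
      using c c' finite_nat_set_iff_bounded[of "{r. c r \<noteq> \<zero>} \<union> {r. c' r \<noteq> \<zero>}"]
      by (auto simp: subset_iff)
    have "(\<Oplus>r\<in>{r. c r \<noteq> \<zero>}. c r) = (\<Oplus>r\<in>{..<N}. c r)"
      "(\<Oplus>r\<in>{r. c' r \<noteq> \<zero>}. c' r) = (\<Oplus>r\<in>{..<N}. c' r)"
      using N carr by (auto intro!: finsum_superset)
    then have x: "x = (\<Oplus>r\<in>{..<N}. c r)" "x = (\<Oplus>r\<in>{..<N}. c' r)"
      using c c' by simp_all
    define D where "D = (\<Oplus>r\<in>{..<N}. c r \<ominus> c' r)"
    have "D \<in> carrier R"
      unfolding D_def using carr by (intro finsum_closed) auto
    have "D \<oplus> (\<Oplus>r\<in>{..<N}. c' r) = (\<Oplus>r\<in>{..<N}. c r)"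
      unfolding D_def using carr by (subst finsum_addf[symmetric])
        (auto intro!: finsum_cong' simp: a_minus_def a_assoc l_neg)
    then have "D \<oplus> x = x"
      unfolding x(1)[symmetric] x(2)[symmetric] .
    moreover have "D = (D \<oplus> x) \<ominus> x"
      using \<open>D \<in> carrier R\<close> \<open>x \<in> carrier R\<close> by (simp add: a_minus_def a_assoc r_neg)
    ultimately have sum0: "(\<Oplus>r\<in>{..<N}. c r \<ominus> c' r) = \<zero>"
      using \<open>x \<in> carrier R\<close> by (simp add: D_def a_minus_def r_neg)
    have "c r = c' r" for r
    proof (cases "r < N")
      case True
      have "c r \<ominus> c' r = \<zero>"
        by (rule indep[OF _ sum0 True]) (use c c' minus in blast)
      then show ?thesis
        using carr minus_equality[of "c r" "\<ominus> c' r"] by (simp add: a_minus_def)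
    next
      case False
      then have "c r = \<zero>" "c' r = \<zero>" using N by auto
      then show ?thesis by simp
    qed
    then show "c = c'" by blast
  qed
  show ?thesis
    by (intro graded_cring.intro graded_cring_axioms.intro) (fact assms ex1)+
qed

context graded_cring
begin

lemma piece_carrier: "x \<in> piece R r \<Longrightarrow> x \<in> carrier R"
  using subgroup.subset[OF piece_subgroup[of r]] by auto

lemma piece_zero: "\<zero> \<in> piece R r"
  using subgroup.one_closed[OF piece_subgroup[of r]] by simp

lemma piece_add: "x \<in> piece R r \<Longrightarrow> y \<in> piece R r \<Longrightarrow> x \<oplus> y \<in> piece R r"
  using subgroup.m_closed[OF piece_subgroup[of r]] by simp

lemma piece_uminus: "x \<in> piece R r \<Longrightarrow> \<ominus> x \<in> piece R r"
  using subgroup.m_inv_closed[OF piece_subgroup[of r]] by (simp add: a_inv_def)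

text \<open>With \<open>independence\<close> this is the converse of \<open>graded_cringI\<close>;
  from here on gradings are handled only through sums over \<open>{..<N}\<close>.\<close>

lemma decomposition:
  assumes "x \<in> carrier R"
  obtains N g where "\<And>r. g r \<in> piece R r" "x = (\<Oplus>r\<in>{..<N::nat}. g r)"
proof -
  obtain c where c: "\<forall>r. c r \<in> piece R r" "finite {r. c r \<noteq> \<zero>}" "x = (\<Oplus>r\<in>{r. c r \<noteq> \<zero>}. c r)"
    using piece_direct[OF assms] by blast
  then obtain N where N: "{r. c r \<noteq> \<zero>} \<subseteq> {..<N}"
    unfolding finite_nat_set_iff_bounded by auto
  then have "x = (\<Oplus>r\<in>{..<N}. c r)"
    unfolding c(3) using c(1) piece_carrier by (intro finsum_superset) auto
  with c(1) that show ?thesis by blast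
qed

lemma independence:
  assumes g: "\<And>r. g r \<in> piece R r" and sum: "(\<Oplus>r\<in>{..<N::nat}. g r) = \<zero>" and "r < N"
  shows "g r = \<zero>"
proof -
  define c where "c = (\<lambda>r. if r < N then g r else \<zero>)"
  have c: "c r \<in> piece R r" for r
    using g piece_zero by (simp add: c_def)
  have "{r. c r \<noteq> \<zero>} \<subseteq> {..<N}"
    by (auto simp: c_def split: if_splits)
  moreover from this have "finite {r. c r \<noteq> \<zero>}"
    by (rule finite_subset) simp
  moreover have "(\<Oplus>r\<in>{r. c r \<noteq> \<zero>}. c r) = (\<Oplus>r\<in>{..<N}. c r)"
    using calculation c piece_carrier by (intro finsum_superset) auto
  moreover have "(\<Oplus>r\<in>{..<N}. c r) = (\<Oplus>r\<in>{..<N}. g r)"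
    using g piece_carrier by (intro finsum_cong') (auto simp: c_def)
  ultimately have *: "(\<forall>r. c r \<in> piece R r) \<and> finite {r. c r \<noteq> \<zero>} \<and> \<zero> = (\<Oplus>r\<in>{r. c r \<noteq> \<zero>}. c r)"
    using c sum by simp
  \<comment> \<open>The zero family is a competing decomposition of zero, so uniqueness forces the
    cut-off family to vanish.\<close>
  have "(\<forall>r. \<zero> \<in> piece R r) \<and> finite {r. \<zero> \<noteq> \<zero>} \<and> \<zero> = (\<Oplus>r\<in>{r::nat. \<zero> \<noteq> \<zero>}. \<zero>)"
    by (simp add: piece_zero)
  with * have "c = (\<lambda>r. \<zero>)"
    using ex1_iff_ex_Uniq[THEN iffD1, THEN conjunct2, OF piece_direct[OF zero_closed]]
    by (auto dest: Uniq_D)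
  then have "c r = \<zero>" by (rule fun_cong)
  with \<open>r < N\<close> show ?thesis by (simp add: c_def)
qed

end

section \<open>Graded homomorphisms\<close>

lemma graded_homI:
  assumes "\<And>x. x \<in> carrier R \<Longrightarrow> f x \<in> carrier S"
    and "\<And>x y. x \<in> carrier R \<Longrightarrow> y \<in> carrier R \<Longrightarrow> f (x \<otimes>\<^bsub>R\<^esub> y) = f x \<otimes>\<^bsub>S\<^esub> f y"
    and "\<And>x y. x \<in> carrier R \<Longrightarrow> y \<in> carrier R \<Longrightarrow> f (x \<oplus>\<^bsub>R\<^esub> y) = f x \<oplus>\<^bsub>S\<^esub> f y"
    and "f \<one>\<^bsub>R\<^esub> = \<one>\<^bsub>S\<^esub>"
    and "\<And>x r. x \<in> piece R r \<Longrightarrow> f x \<in> piece S r"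
  shows "f \<in> graded_hom R S"
  using assms by (auto simp: graded_hom_def intro!: ring_hom_memI)

lemma graded_hom_ring_hom: "f \<in> graded_hom R S \<Longrightarrow> f \<in> ring_hom R S"
  by (simp add: graded_hom_def)

lemma graded_hom_piece: "f \<in> graded_hom R S \<Longrightarrow> x \<in> piece R r \<Longrightarrow> f x \<in> piece S r"
  by (auto simp: graded_hom_def)

lemma graded_hom_compose:
  "f \<in> graded_hom R S \<Longrightarrow> g \<in> graded_hom S T \<Longrightarrow> (\<lambda>x. g (f x)) \<in> graded_hom R T"
  using ring_hom_trans[of f R S g T] by (simp add: graded_hom_def comp_def image_subset_iff)

lemma graded_hom_finsum:
  assumes "graded_cring R" "graded_cring S" "f \<in> graded_hom R S" "\<And>i. i \<in> F \<Longrightarrow> g i \<in> carrier R"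
  shows "f (\<Oplus>\<^bsub>R\<^esub>i\<in>F. g i) = (\<Oplus>\<^bsub>S\<^esub>i\<in>F. f (g i))"
proof -
  interpret R: graded_cring R by fact
  interpret S: graded_cring S by fact
  interpret ring_hom_cring R S f
    using assms(3) by unfold_locales (rule graded_hom_ring_hom)
  show ?thesis using assms(4) by (subst hom_finsum) (auto simp: comp_def)
qed

section \<open>Inverse limits of graded rings, with index sets covering both directions\<close>

locale inverse_system =
  fixes J :: "nat set" and A :: "nat \<Rightarrow> 'a graded_ring" and \<pi> :: "nat \<Rightarrow> 'a \<Rightarrow> 'a"
  assumes up_closed: "j \<in> J \<Longrightarrow> Suc j \<in> J"
    and graded_cring: "j \<in> J \<Longrightarrow> graded_cring (A j)"
    and transition: "j \<in> J \<Longrightarrow> \<pi> (Suc j) \<in> graded_hom (A (Suc j)) (A j)"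
begin

abbreviation L :: "(nat \<Rightarrow> 'a) graded_ring" where
  "L \<equiv> graded_lim J A \<pi>"

lemma L_simps:
  "\<one>\<^bsub>L\<^esub> = (\<lambda>j\<in>J. \<one>\<^bsub>A j\<^esub>)" "\<zero>\<^bsub>L\<^esub> = (\<lambda>j\<in>J. \<zero>\<^bsub>A j\<^esub>)"
  "f \<otimes>\<^bsub>L\<^esub> g = (\<lambda>j\<in>J. f j \<otimes>\<^bsub>A j\<^esub> g j)" "f \<oplus>\<^bsub>L\<^esub> g = (\<lambda>j\<in>J. f j \<oplus>\<^bsub>A j\<^esub> g j)"
  "piece L r = lim_piece J A \<pi> r"
  by (simp_all add: graded_lim_def)

lemma lim_piece_piece: "f \<in> lim_piece J A \<pi> r \<Longrightarrow> j \<in> J \<Longrightarrow> f j \<in> piece (A j) r"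
  by (auto simp: lim_piece_def)

lemma lim_piece_carrier: "f \<in> lim_piece J A \<pi> r \<Longrightarrow> j \<in> J \<Longrightarrow> f j \<in> carrier (A j)"
  by (rule graded_cring.piece_carrier[OF graded_cring lim_piece_piece])

lemma lim_piece_zero: "(\<lambda>j\<in>J. \<zero>\<^bsub>A j\<^esub>) \<in> lim_piece J A \<pi> r"
proof -
  have "\<pi> (Suc j) \<zero>\<^bsub>A (Suc j)\<^esub> = \<zero>\<^bsub>A j\<^esub>" if "j \<in> J" for j
    \<comment> \<open>The empty sum is used here to see that the transition maps preserve
      zero.\<close>
    using graded_hom_finsum[OF graded_cring[OF up_closed[OF that]] graded_cring[OF that] transition[OF that], of "{}"]
      graded_cring[OF that] graded_cring[OF up_closed[OF that]]
    by (simp add: graded_cring_def cring_def ring_def abelian_group_def abelian_monoid.finsum_empty)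
  then show ?thesis
    by (auto simp: lim_piece_def up_closed graded_cring graded_cring.piece_zero)
qed

lemma lim_piece_pointwise:
  assumes "f \<in> lim_piece J A \<pi> r" "g \<in> lim_piece J A \<pi> s"
  shows "(\<lambda>j\<in>J. f j \<otimes>\<^bsub>A j\<^esub> g j) \<in> lim_piece J A \<pi> (r + s)"
    and "r = s \<Longrightarrow> (\<lambda>j\<in>J. f j \<oplus>\<^bsub>A j\<^esub> g j) \<in> lim_piece J A \<pi> r"
proof -
  have compat: "\<pi> (Suc j) (f (Suc j)) = f j" "\<pi> (Suc j) (g (Suc j)) = g j" if "j \<in> J" for j
    using assms that by (auto simp: lim_piece_def)
  show "(\<lambda>j\<in>J. f j \<otimes>\<^bsub>A j\<^esub> g j) \<in> lim_piece J A \<pi> (r + s)"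
    using assms lim_piece_piece[OF assms(1)] lim_piece_piece[OF assms(2)]
      lim_piece_carrier[OF assms(1)] lim_piece_carrier[OF assms(2)]
    by (auto simp: lim_piece_def up_closed compat graded_cring graded_cring.piece_mult
        ring_hom_mult[OF graded_hom_ring_hom[OF transition]])
  show "(\<lambda>j\<in>J. f j \<oplus>\<^bsub>A j\<^esub> g j) \<in> lim_piece J A \<pi> r" if "r = s"
    using assms lim_piece_piece[OF assms(1)] lim_piece_piece[OF assms(2)] that
      lim_piece_carrier[OF assms(1)] lim_piece_carrier[OF assms(2)]
    by (auto simp: lim_piece_def up_closed compat graded_cring graded_cring.piece_add
        ring_hom_add[OF graded_hom_ring_hom[OF transition]])
qed

lemma lim_piece_uminus:
  assumes "f \<in> lim_piece J A \<pi> r"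
  shows "(\<lambda>j\<in>J. \<ominus>\<^bsub>A j\<^esub> f j) \<in> lim_piece J A \<pi> r"
proof -
  have "\<pi> (Suc j) (\<ominus>\<^bsub>A (Suc j)\<^esub> f (Suc j)) = \<ominus>\<^bsub>A j\<^esub> f j" if "j \<in> J" for j
  proof -
    interpret R: graded_cring "A (Suc j)" using that by (intro graded_cring up_closed)
    interpret S: graded_cring "A j" using that by (rule graded_cring)
    interpret ring_hom_cring "A (Suc j)" "A j" "\<pi> (Suc j)"
      using transition[OF that] by unfold_locales (rule graded_hom_ring_hom)
    show ?thesis
      using assms that lim_piece_carrier[OF assms up_closed[OF that]] by (simp add: lim_piece_def)
  qed
  then show ?thesis
    using lim_piece_piece[OF assms]
    by (auto simp: lim_piece_def up_closed graded_cring graded_cring.piece_uminus)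
qed

lemma lim_piece_one: "(\<lambda>j\<in>J. \<one>\<^bsub>A j\<^esub>) \<in> lim_piece J A \<pi> 0"
  by (auto simp: lim_piece_def up_closed graded_cring graded_cring.piece_one
      ring_hom_one[OF graded_hom_ring_hom[OF transition]])

text \<open>The definition of the limit constrains \<open>g r\<close> only for \<open>r < N\<close>.
  Padding with zero yields a family that is homogeneous in every degree, the form required by
  \<open>carrierI\<close> and by gradings.\<close>

lemma carrierE:
  assumes "f \<in> carrier L"
  obtains N g where "\<And>r. g r \<in> lim_piece J A \<pi> r" "\<And>j. j \<in> J \<Longrightarrow> f j = (\<Oplus>\<^bsub>A j\<^esub>r\<in>{..<N::nat}. g r j)"
    "f \<in> extensional J"
proof -
  obtain N g where f: "f = (\<lambda>j\<in>J. \<Oplus>\<^bsub>A j\<^esub>r\<in>{..<N}. g r j)" and g: "\<forall>r<N. g r \<in> lim_piece J A \<pi> r"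
    using assms by (auto simp: graded_lim_def)
  define g' where "g' = (\<lambda>r. if r < N then g r else (\<lambda>j\<in>J. \<zero>\<^bsub>A j\<^esub>))"
  have g': "g' r \<in> lim_piece J A \<pi> r" for r
    using g lim_piece_zero by (simp add: g'_def)
  have "f j = (\<Oplus>\<^bsub>A j\<^esub>r\<in>{..<N}. g' r j)" if "j \<in> J" for j
  proof -
    interpret graded_cring "A j" using that by (rule graded_cring)
    have "(\<Oplus>\<^bsub>A j\<^esub>r\<in>{..<N}. g r j) = (\<Oplus>\<^bsub>A j\<^esub>r\<in>{..<N}. g' r j)"
      using lim_piece_carrier[OF g' that] by (intro finsum_cong') (auto simp: g'_def)
    with that f show ?thesis by simp
  qed
  with g' f show thesis by (intro that[of g' N]) auto
qed

lemma carrierI: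
  assumes "f \<in> extensional J" "\<And>r. g r \<in> lim_piece J A \<pi> r" "\<And>j. j \<in> J \<Longrightarrow> f j = (\<Oplus>\<^bsub>A j\<^esub>r\<in>{..<N::nat}. g r j)"
  shows "f \<in> carrier L"
proof -
  have "f = (\<lambda>j\<in>J. \<Oplus>\<^bsub>A j\<^esub>r\<in>{..<N}. g r j)"
    by (rule extensionalityI[OF assms(1)]) (simp_all add: assms(3))
  with assms(2) have "\<exists>N g. f = (\<lambda>j\<in>J. \<Oplus>\<^bsub>A j\<^esub>r\<in>{..<N}. g r j) \<and> (\<forall>r<N. g r \<in> lim_piece J A \<pi> r)"
    by blast
  then show ?thesis
    by (simp add: graded_lim_def)
qed

lemma carrier_carrier: "f \<in> carrier L \<Longrightarrow> j \<in> J \<Longrightarrow> f j \<in> carrier (A j)"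
proof (elim carrierE)
  fix N and g :: "nat \<Rightarrow> nat \<Rightarrow> 'a"
  assume "j \<in> J" and g: "\<And>r. g r \<in> lim_piece J A \<pi> r"
    and f: "\<And>j. j \<in> J \<Longrightarrow> f j = (\<Oplus>\<^bsub>A j\<^esub>r\<in>{..<N::nat}. g r j)"
  interpret graded_cring "A j" using \<open>j \<in> J\<close> by (rule graded_cring)
  show "f j \<in> carrier (A j)"
    unfolding f[OF \<open>j \<in> J\<close>] using lim_piece_carrier[OF g \<open>j \<in> J\<close>] by (intro finsum_closed) auto
qed

lemma carrier_extensional: "f \<in> carrier L \<Longrightarrow> f \<in> extensional J"
  by (elim carrierE)

lemma carrier_eqI: "f \<in> carrier L \<Longrightarrow> g \<in> carrier L \<Longrightarrow> (\<And>j. j \<in> J \<Longrightarrow> f j = g j) \<Longrightarrow> f = g"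
  by (rule extensionalityI[OF carrier_extensional carrier_extensional])

lemma lim_piece_subset: 
  assumes "f \<in> lim_piece J A \<pi> r"
  shows "f \<in> carrier L"
proof (rule carrierI)
  \<comment> \<open>The family is concentrated in degree \<open>r\<close>, so summing up to and
    including \<open>r\<close> suffices.\<close>
  define g where "g = (\<lambda>s. if s = r then f else (\<lambda>j\<in>J. \<zero>\<^bsub>A j\<^esub>))"
  show "g s \<in> lim_piece J A \<pi> s" for s
    using assms lim_piece_zero by (simp add: g_def)
  show "f j = (\<Oplus>\<^bsub>A j\<^esub>s\<in>{..<Suc r}. g s j)" if "j \<in> J" for j
  proof -
    interpret graded_cring "A j" using that by (rule graded_cring)
    have "(\<Oplus>\<^bsub>A j\<^esub>s\<in>{r}. g s j) = (\<Oplus>\<^bsub>A j\<^esub>s\<in>{..<Suc r}. g s j)"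
      using lim_piece_carrier[OF assms that] that by (intro finsum_superset) (auto simp: g_def)
    then show ?thesis
      using lim_piece_carrier[OF assms that] by (simp add: g_def)
  qed
  show "f \<in> extensional J"
    using assms by (simp add: lim_piece_def PiE_iff)
qed

lemma carrier_add:
  assumes "f \<in> carrier L" "g \<in> carrier L"
  shows "f \<oplus>\<^bsub>L\<^esub> g \<in> carrier L"
proof -
  obtain M a where a: "\<And>r. a r \<in> lim_piece J A \<pi> r" "\<And>j. j \<in> J \<Longrightarrow> f j = (\<Oplus>\<^bsub>A j\<^esub>r\<in>{..<M::nat}. a r j)"
    using assms(1) by (rule carrierE) blast
  obtain N b where b: "\<And>r. b r \<in> lim_piece J A \<pi> r" "\<And>j. j \<in> J \<Longrightarrow> g j = (\<Oplus>\<^bsub>A j\<^esub>r\<in>{..<N::nat}. b r j)"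
    using assms(2) by (rule carrierE) blast
  \<comment> \<open>The two decompositions may have different lengths; with zeros added, both can be
    summed up to \<open>max M N\<close>.\<close>
  define a' where "a' = (\<lambda>r. if r < M then a r else (\<lambda>j\<in>J. \<zero>\<^bsub>A j\<^esub>))"
  define b' where "b' = (\<lambda>r. if r < N then b r else (\<lambda>j\<in>J. \<zero>\<^bsub>A j\<^esub>))"
  have a': "a' r \<in> lim_piece J A \<pi> r" and b': "b' r \<in> lim_piece J A \<pi> r" for r
    using a(1) b(1) lim_piece_zero by (simp_all add: a'_def b'_def)
  show ?thesis
  proof (rule carrierI)
    show "(\<lambda>j\<in>J. a' r j \<oplus>\<^bsub>A j\<^esub> b' r j) \<in> lim_piece J A \<pi> r" for r
      by (rule lim_piece_pointwise(2)[OF a' b']) simp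
    show "(f \<oplus>\<^bsub>L\<^esub> g) j = (\<Oplus>\<^bsub>A j\<^esub>r\<in>{..<max M N}. (\<lambda>j\<in>J. a' r j \<oplus>\<^bsub>A j\<^esub> b' r j) j)" if "j \<in> J" for j
    proof -
      interpret graded_cring "A j" using that by (rule graded_cring)
      note carr = lim_piece_carrier[OF a' that] lim_piece_carrier[OF b' that]
        lim_piece_carrier[OF a(1) that] lim_piece_carrier[OF b(1) that]
      have "f j = (\<Oplus>\<^bsub>A j\<^esub>r\<in>{..<M}. a' r j)" "g j = (\<Oplus>\<^bsub>A j\<^esub>r\<in>{..<N}. b' r j)"
        unfolding a(2)[OF that] b(2)[OF that] using carr by (auto intro!: finsum_cong' simp: a'_def b'_def)
      moreover have "(\<Oplus>\<^bsub>A j\<^esub>r\<in>{..<M}. a' r j) = (\<Oplus>\<^bsub>A j\<^esub>r\<in>{..<max M N}. a' r j)"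
        "(\<Oplus>\<^bsub>A j\<^esub>r\<in>{..<N}. b' r j) = (\<Oplus>\<^bsub>A j\<^esub>r\<in>{..<max M N}. b' r j)"
        using carr that by (auto intro!: finsum_superset simp: a'_def b'_def split: if_splits)
      ultimately show ?thesis
        using carr that by (simp add: L_simps finsum_addf)
    qed
  qed (simp add: L_simps)
qed

lemma abelian_group_L: "abelian_group L"
proof (rule abelian_groupI)
  show "\<zero>\<^bsub>L\<^esub> \<in> carrier L"
    using lim_piece_zero by (simp add: L_simps lim_piece_subset)
next
  fix f assume f: "f \<in> carrier L"
  then obtain N a where a: "\<And>r. a r \<in> lim_piece J A \<pi> r" "\<And>j. j \<in> J \<Longrightarrow> f j = (\<Oplus>\<^bsub>A j\<^esub>r\<in>{..<N::nat}. a r j)"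
    by (rule carrierE) blast
  have "(\<lambda>j\<in>J. \<ominus>\<^bsub>A j\<^esub> f j) \<in> carrier L"
  proof (rule carrierI)
    show "(\<lambda>j\<in>J. \<ominus>\<^bsub>A j\<^esub> a r j) \<in> lim_piece J A \<pi> r" for r
      by (rule lim_piece_uminus[OF a(1)])
    show "(\<lambda>j\<in>J. \<ominus>\<^bsub>A j\<^esub> f j) j = (\<Oplus>\<^bsub>A j\<^esub>r\<in>{..<N}. (\<lambda>j\<in>J. \<ominus>\<^bsub>A j\<^esub> a r j) j)" if "j \<in> J" for j
    proof -
      interpret graded_cring "A j" using that by (rule graded_cring)
      note carr = lim_piece_carrier[OF a(1) that]
      \<comment> \<open>The sum of the negatives is a left inverse of \<open>f j\<close>, hence
        equal to its negative.\<close>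
      have "(\<Oplus>\<^bsub>A j\<^esub>r\<in>{..<N}. \<ominus>\<^bsub>A j\<^esub> a r j) \<oplus>\<^bsub>A j\<^esub> f j = (\<Oplus>\<^bsub>A j\<^esub>r\<in>{..<N}. \<zero>\<^bsub>A j\<^esub>)"
        unfolding a(2)[OF that] using carr
        by (subst finsum_addf[symmetric]) (auto intro!: finsum_cong' simp: l_neg simp del: finsum_zero)
      then show ?thesis
        using carr carrier_carrier[OF f that] that by (simp add: minus_equality Pi_def)
    qed
  qed simp
  moreover have "(\<lambda>j\<in>J. \<ominus>\<^bsub>A j\<^esub> f j) \<oplus>\<^bsub>L\<^esub> f = \<zero>\<^bsub>L\<^esub>"
    using carrier_carrier[OF f] graded_cring
    by (auto simp: L_simps graded_cring_def cring_def ring_def intro!: restrict_ext abelian_group.l_neg)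
  ultimately show "\<exists>g\<in>carrier L. g \<oplus>\<^bsub>L\<^esub> f = \<zero>\<^bsub>L\<^esub>" by blast
next
  fix f g h assume *: "f \<in> carrier L" "g \<in> carrier L" "h \<in> carrier L"
  note carr = this[THEN carrier_carrier]
  have ab: "abelian_monoid (A j)" if "j \<in> J" for j
    using graded_cring[OF that] by (simp add: graded_cring_def cring_def ring_def abelian_group_def)
  show "f \<oplus>\<^bsub>L\<^esub> g \<in> carrier L" using * by (intro carrier_add)
  show "f \<oplus>\<^bsub>L\<^esub> g \<oplus>\<^bsub>L\<^esub> h = f \<oplus>\<^bsub>L\<^esub> (g \<oplus>\<^bsub>L\<^esub> h)"
    using carr by (auto simp: L_simps abelian_monoid.a_assoc[OF ab] intro!: restrict_ext)
  show "f \<oplus>\<^bsub>L\<^esub> g = g \<oplus>\<^bsub>L\<^esub> f"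
    using carr by (auto simp: L_simps abelian_monoid.a_comm[OF ab] intro!: restrict_ext)
  show "\<zero>\<^bsub>L\<^esub> \<oplus>\<^bsub>L\<^esub> f = f"
    using carr carrier_extensional[OF *(1)]
    by (auto simp: L_simps abelian_monoid.l_zero[OF ab] intro!: extensionalityI[of _ J])
qed

text \<open>Sums in the limit are computed termwise, which reduces questions about them to the rings
  \<open>A j\<close>.\<close>

lemma finsum_L:
  assumes "finite F" "\<And>i. i \<in> F \<Longrightarrow> g i \<in> carrier L"
  shows "(\<Oplus>\<^bsub>L\<^esub>i\<in>F. g i) = (\<lambda>j\<in>J. \<Oplus>\<^bsub>A j\<^esub>i\<in>F. g i j)"
  using assms
proof (induction F rule: finite_induct)
  have ab: "abelian_monoid (A j)" if "j \<in> J" for j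
    using graded_cring[OF that] by (simp add: graded_cring_def cring_def ring_def abelian_group_def)
  interpret L: abelian_group L by (rule abelian_group_L)
  {
    case empty
    show ?case
      by (auto simp: L_simps abelian_monoid.finsum_empty[OF ab] intro!: restrict_ext)
  next
    case (insert i F)
    then have "g \<in> F \<rightarrow> carrier L" "g i \<in> carrier L" by auto
    moreover have "(\<Oplus>\<^bsub>A j\<^esub>i\<in>insert i F. g i j) = g i j \<oplus>\<^bsub>A j\<^esub> (\<Oplus>\<^bsub>A j\<^esub>i\<in>F. g i j)" if "j \<in> J" for j
      using insert.hyps insert.prems that
      by (intro abelian_monoid.finsum_insert[OF ab]) (auto intro: carrier_carrier)
    ultimately show ?case
      using insert by (auto simp: L_simps intro!: restrict_ext)
  }
qed

text \<open>Products of homogeneous components lie in the degreewise limits, and distributivity at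
  each index writes \<open>f \<otimes> g\<close> as a finite double sum of them. Collecting terms by
  degree is avoided because closure under addition is already known.\<close>

lemma carrier_mult:
  assumes "f \<in> carrier L" "g \<in> carrier L"
  shows "f \<otimes>\<^bsub>L\<^esub> g \<in> carrier L"
proof -
  interpret L: abelian_group L by (rule abelian_group_L)
  obtain M a where a: "\<And>r. a r \<in> lim_piece J A \<pi> r" "\<And>j. j \<in> J \<Longrightarrow> f j = (\<Oplus>\<^bsub>A j\<^esub>r\<in>{..<M::nat}. a r j)"
    using assms(1) by (rule carrierE) blast
  obtain N b where b: "\<And>r. b r \<in> lim_piece J A \<pi> r" "\<And>j. j \<in> J \<Longrightarrow> g j = (\<Oplus>\<^bsub>A j\<^esub>r\<in>{..<N::nat}. b r j)"
    using assms(2) by (rule carrierE) blast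
  have ab: "a r \<otimes>\<^bsub>L\<^esub> b s \<in> carrier L" for r s
    unfolding L_simps by (rule lim_piece_subset[OF lim_piece_pointwise(1)[OF a(1) b(1)]])
  then have *: "(\<Oplus>\<^bsub>L\<^esub>s\<in>{..<N}. a r \<otimes>\<^bsub>L\<^esub> b s) \<in> carrier L" for r
    by (intro L.finsum_closed) auto
  have "f j \<otimes>\<^bsub>A j\<^esub> g j = (\<Oplus>\<^bsub>A j\<^esub>r\<in>{..<M}. \<Oplus>\<^bsub>A j\<^esub>s\<in>{..<N}. a r j \<otimes>\<^bsub>A j\<^esub> b s j)" if "j \<in> J" for j
  proof -
    interpret graded_cring "A j" using that by (rule graded_cring)
    note carr = lim_piece_carrier[OF a(1) that] lim_piece_carrier[OF b(1) that]
    have "g j \<in> carrier (A j)"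
      using carr by (simp add: b(2)[OF that] finsum_closed Pi_def)
    then have "f j \<otimes>\<^bsub>A j\<^esub> g j = (\<Oplus>\<^bsub>A j\<^esub>r\<in>{..<M}. a r j \<otimes>\<^bsub>A j\<^esub> g j)"
      using carr by (simp add: a(2)[OF that] finsum_ldistr Pi_def)
    also have "\<dots> = (\<Oplus>\<^bsub>A j\<^esub>r\<in>{..<M}. \<Oplus>\<^bsub>A j\<^esub>s\<in>{..<N}. a r j \<otimes>\<^bsub>A j\<^esub> b s j)"
      using carr by (intro finsum_cong') (auto simp: b(2)[OF that] finsum_rdistr Pi_def intro!: finsum_closed)
    finally show ?thesis .
  qed
  then have "f \<otimes>\<^bsub>L\<^esub> g = (\<Oplus>\<^bsub>L\<^esub>r\<in>{..<M}. \<Oplus>\<^bsub>L\<^esub>s\<in>{..<N}. a r \<otimes>\<^bsub>L\<^esub> b s)"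
    using finsum_L[OF _ *, of "{..<M}" "\<lambda>r. r"] finsum_L[OF _ ab, of "{..<N}" _ "\<lambda>s. s"]
    by (simp add: L_simps cong: restrict_cong)
  also have "\<dots> \<in> carrier L"
    using * by (intro L.finsum_closed) auto
  finally show ?thesis .
qed

text \<open>The ring laws hold termwise. Directness of the grading is inherited as well: a vanishing
  sum vanishes at each index \<open>j\<close>, where the components are independent.\<close>

theorem graded_cring_L: "graded_cring L"
proof (rule graded_cringI)
  interpret L: abelian_group L by (rule abelian_group_L)
  have R: "cring (A j)" if "j \<in> J" for j
    using graded_cring[OF that] by (simp add: graded_cring_def)
  have rdist: "semiring (A j)" if "j \<in> J" for j
  proof -
    interpret cring "A j" by (rule R[OF that])
    show ?thesis by unfold_locales
  qed
  have mon: "comm_monoid (A j)" if "j \<in> J" for j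
    using R[OF that] by (simp add: cring_def)
  show "cring L"
  proof (rule cringI)
    show "abelian_group L" by (rule abelian_group_L)
    show "comm_monoid L"
    proof (rule comm_monoidI)
      show "\<one>\<^bsub>L\<^esub> \<in> carrier L"
        unfolding L_simps by (rule lim_piece_subset[OF lim_piece_one])
    next
      fix f g h assume *: "f \<in> carrier L" "g \<in> carrier L" "h \<in> carrier L"
      note carr = this[THEN carrier_carrier]
      show "f \<otimes>\<^bsub>L\<^esub> g \<in> carrier L" using * by (intro carrier_mult)
      show "f \<otimes>\<^bsub>L\<^esub> g \<otimes>\<^bsub>L\<^esub> h = f \<otimes>\<^bsub>L\<^esub> (g \<otimes>\<^bsub>L\<^esub> h)"
        using carr by (auto simp: L_simps monoid.m_assoc[OF comm_monoid.axioms(1)[OF mon]] intro!: restrict_ext)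
      show "f \<otimes>\<^bsub>L\<^esub> g = g \<otimes>\<^bsub>L\<^esub> f"
        using carr by (auto simp: L_simps comm_monoid.m_comm[OF mon] intro!: restrict_ext)
      show "\<one>\<^bsub>L\<^esub> \<otimes>\<^bsub>L\<^esub> f = f"
        using carr carrier_extensional[OF *(1)]
        by (auto simp: L_simps monoid.l_one[OF comm_monoid.axioms(1)[OF mon]] intro!: extensionalityI[of _ J])
    qed
    fix f g h assume *: "f \<in> carrier L" "g \<in> carrier L" "h \<in> carrier L"
    note carr = this[THEN carrier_carrier]
    show "(f \<oplus>\<^bsub>L\<^esub> g) \<otimes>\<^bsub>L\<^esub> h = f \<otimes>\<^bsub>L\<^esub> h \<oplus>\<^bsub>L\<^esub> g \<otimes>\<^bsub>L\<^esub> h"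
      using carr by (auto simp: L_simps semiring.l_distr[OF rdist] intro!: restrict_ext)
  qed
  show "subgroup (piece L r) (add_monoid L)" for r
  proof (rule group.subgroupI[OF L.a_group])
    show "piece L r \<subseteq> carrier (add_monoid L)" by (auto simp: L_simps lim_piece_subset)
    show "piece L r \<noteq> {}" using lim_piece_zero by (auto simp: L_simps)
    fix f assume f: "f \<in> piece L r"
    then have "f \<in> carrier L" "(\<lambda>j\<in>J. \<ominus>\<^bsub>A j\<^esub> f j) \<in> carrier L"
      using lim_piece_subset[of _ r] lim_piece_uminus[of _ r] by (auto simp: L_simps)
    moreover from this have "(\<lambda>j\<in>J. \<ominus>\<^bsub>A j\<^esub> f j) \<oplus>\<^bsub>L\<^esub> f = \<zero>\<^bsub>L\<^esub>"
      using carrier_carrier graded_cring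
      by (auto simp: L_simps graded_cring_def cring_def ring_def intro!: restrict_ext abelian_group.l_neg)
    \<comment> \<open>The abstract negative is identified with the termwise one, which is already
      known to stay in the degreewise limit.\<close>
    ultimately have "\<ominus>\<^bsub>L\<^esub> f = (\<lambda>j\<in>J. \<ominus>\<^bsub>A j\<^esub> f j)"
      by (intro L.minus_equality)
    then show "inv\<^bsub>add_monoid L\<^esub> f \<in> piece L r"
      using f lim_piece_uminus by (simp add: a_inv_def L_simps)
  next
    fix f g assume "f \<in> piece L r" "g \<in> piece L r"
    then show "f \<otimes>\<^bsub>add_monoid L\<^esub> g \<in> piece L r"
      using lim_piece_pointwise(2) by (simp add: L_simps)
  qed
  show "\<one>\<^bsub>L\<^esub> \<in> piece L 0"
    unfolding L_simps by (rule lim_piece_one)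
  show "f \<otimes>\<^bsub>L\<^esub> g \<in> piece L (r + s)" if "f \<in> piece L r" "g \<in> piece L s" for f g r s
    using that unfolding L_simps by (rule lim_piece_pointwise(1))
  show "\<exists>N g. (\<forall>r. g r \<in> piece L r) \<and> f = (\<Oplus>\<^bsub>L\<^esub>r\<in>{..<N}. g r)" if "f \<in> carrier L" for f
    using that
  proof (rule carrierE)
    fix N and g :: "nat \<Rightarrow> nat \<Rightarrow> 'a"
    assume g: "\<And>r. g r \<in> lim_piece J A \<pi> r" and "f \<in> extensional J"
      and f: "\<And>j. j \<in> J \<Longrightarrow> f j = (\<Oplus>\<^bsub>A j\<^esub>r\<in>{..<N::nat}. g r j)"
    then have "f = (\<Oplus>\<^bsub>L\<^esub>r\<in>{..<N}. g r)"
      by (subst finsum_L) (auto intro: lim_piece_subset intro!: extensionalityI[of _ J])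
    with g show ?thesis by (auto simp: L_simps)
  qed
  show "g r = \<zero>\<^bsub>L\<^esub>"
    if g: "\<And>r. g r \<in> piece L r" and sum: "(\<Oplus>\<^bsub>L\<^esub>r\<in>{..<N}. g r) = \<zero>\<^bsub>L\<^esub>" and "r < N" for g N r
  proof (rule carrier_eqI)
    have g': "g r \<in> lim_piece J A \<pi> r" for r
      using g by (simp add: L_simps)
    show "g r \<in> carrier L" "\<zero>\<^bsub>L\<^esub> \<in> carrier L"
      using lim_piece_subset[OF g'] by auto
    fix j assume j: "j \<in> J"
    have "(\<Oplus>\<^bsub>A j\<^esub>r\<in>{..<N}. g r j) = \<zero>\<^bsub>A j\<^esub>"
      using fun_cong[OF sum, of j] j lim_piece_subset[OF g'] by (simp add: finsum_L L_simps)
    then have "g r j = \<zero>\<^bsub>A j\<^esub>"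
      using graded_cring.independence[OF graded_cring[OF j], of "\<lambda>r. g r j"] lim_piece_piece[OF g' j] \<open>r < N\<close>
      by blast
    with j show "g r j = \<zero>\<^bsub>L\<^esub> j" by (simp add: L_simps)
  qed
qed

lemma eval_graded_hom: "j \<in> J \<Longrightarrow> (\<lambda>f. f j) \<in> graded_hom L (A j)"
  by (rule graded_homI) (auto simp: L_simps carrier_carrier lim_piece_piece)

text \<open>Compatibility is built only into the homogeneous components; it extends to their sums
  because the transition maps are additive.\<close>

lemma carrier_compatible:
  assumes "f \<in> carrier L" "j \<in> J"
  shows "\<pi> (Suc j) (f (Suc j)) = f j"
proof -
  obtain N g where g: "\<And>r. g r \<in> lim_piece J A \<pi> r" "\<And>j. j \<in> J \<Longrightarrow> f j = (\<Oplus>\<^bsub>A j\<^esub>r\<in>{..<N::nat}. g r j)"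
    using assms(1) by (rule carrierE) blast
  have "\<pi> (Suc j) (f (Suc j)) = (\<Oplus>\<^bsub>A j\<^esub>r\<in>{..<N}. \<pi> (Suc j) (g r (Suc j)))"
    unfolding g(2)[OF up_closed[OF assms(2)]]
    using assms(2) lim_piece_carrier[OF g(1) up_closed[OF assms(2)]]
    by (intro graded_hom_finsum graded_cring up_closed transition) auto
  also have "\<dots> = f j"
    using g assms(2) by (simp add: lim_piece_def)
  finally show ?thesis .
qed

text \<open>The decomposition into homogeneous components is what brings the images into the sum of
  the degreewise limits.\<close>

lemma universal_graded_hom:
  assumes "graded_cring R" and P: "\<And>j. j \<in> J \<Longrightarrow> P j \<in> graded_hom R (A j)"
    and compat: "\<And>j x. j \<in> J \<Longrightarrow> x \<in> carrier R \<Longrightarrow> \<pi> (Suc j) (P (Suc j) x) = P j x"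
  shows "(\<lambda>x. \<lambda>j\<in>J. P j x) \<in> graded_hom R L"
proof (rule graded_homI)
  interpret R: graded_cring R by fact
  have piece: "(\<lambda>j\<in>J. P j x) \<in> lim_piece J A \<pi> r" if "x \<in> piece R r" for x r
    using that by (auto simp: lim_piece_def up_closed compat R.piece_carrier intro: graded_hom_piece[OF P])
  then show "(\<lambda>j\<in>J. P j x) \<in> piece L r" if "x \<in> piece R r" for x r
    using that by (simp add: L_simps)
  show "(\<lambda>j\<in>J. P j x) \<in> carrier L" if "x \<in> carrier R" for x
    using that
  proof (rule R.decomposition)
    fix N and g :: "nat \<Rightarrow> _"
    assume g: "\<And>r. g r \<in> piece R r" and x: "x = (\<Oplus>\<^bsub>R\<^esub>r\<in>{..<N::nat}. g r)"
    show ?thesis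
    proof (rule carrierI)
      show "(\<lambda>j\<in>J. P j (g r)) \<in> lim_piece J A \<pi> r" for r by (rule piece[OF g])
      show "(\<lambda>j\<in>J. P j x) j = (\<Oplus>\<^bsub>A j\<^esub>r\<in>{..<N}. (\<lambda>j\<in>J. P j (g r)) j)" if "j \<in> J" for j
        using that R.piece_carrier[OF g] graded_hom_finsum[OF assms(1) graded_cring P, OF that that, of "{..<N}" g]
        by (simp add: x)
    qed simp
  qed
next
  fix x y assume xy: "x \<in> carrier R" "y \<in> carrier R"
  show "(\<lambda>j\<in>J. P j (x \<otimes>\<^bsub>R\<^esub> y)) = (\<lambda>j\<in>J. P j x) \<otimes>\<^bsub>L\<^esub> (\<lambda>j\<in>J. P j y)"
    using ring_hom_mult[OF graded_hom_ring_hom[OF P] xy] by (simp add: L_simps cong: restrict_cong)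
  show "(\<lambda>j\<in>J. P j (x \<oplus>\<^bsub>R\<^esub> y)) = (\<lambda>j\<in>J. P j x) \<oplus>\<^bsub>L\<^esub> (\<lambda>j\<in>J. P j y)"
    using ring_hom_add[OF graded_hom_ring_hom[OF P] xy] by (simp add: L_simps cong: restrict_cong)
next
  show "(\<lambda>j\<in>J. P j \<one>\<^bsub>R\<^esub>) = \<one>\<^bsub>L\<^esub>"
    using ring_hom_one[OF graded_hom_ring_hom[OF P]] by (simp add: L_simps cong: restrict_cong)
qed

end

section \<open>The rings of symmetric series and of symmetric polynomials\<close>

text \<open>\<open>Lam\<close> over an arbitrary set of indeterminates, so that truncation by
  \<open>Z\<close> has the ring over \<open>I - Z\<close> as its target; likewise
  \<open>poly_ring\<close> for \<open>Lam_mk\<close>.\<close>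

definition series_ring :: "indet set \<Rightarrow> series graded_ring" where
  "series_ring I =
    \<lparr>carrier = sym_series I, monoid.mult = conv, one = (\<lambda>t. if t = 0 then 1 else 0),
     zero = (\<lambda>t. 0), add = (\<lambda>c d t. c t + d t),
     piece = (\<lambda>r. {c \<in> sym_series I. \<forall>t. c t \<noteq> 0 \<longrightarrow> mdeg t = r})\<rparr>"

definition poly_ring :: "indet set \<Rightarrow> mpoly graded_ring" where
  "poly_ring I =
    \<lparr>carrier = sym_polys I, monoid.mult = (*), one = 1, zero = 0, add = (+),
     piece = (\<lambda>r. {f \<in> sym_polys I. \<forall>t\<in>keys f. mdeg t = r})\<rparr>"

lemma Lam_eq: "Lam n = series_ring (all_indets n)"
  by (simp add: Lam_def series_ring_def conv_def[abs_def])

lemma Lam_mk_eq: "Lam_mk n m k = poly_ring (indets n m k)"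
  by (simp add: Lam_mk_def poly_ring_def)

lemma series_ring_simps:
  "carrier (series_ring I) = sym_series I" "c \<otimes>\<^bsub>series_ring I\<^esub> d = conv c d"
  "\<one>\<^bsub>series_ring I\<^esub> = (\<lambda>t. if t = 0 then 1 else 0)" "\<zero>\<^bsub>series_ring I\<^esub> = (\<lambda>t. 0)"
  "c \<oplus>\<^bsub>series_ring I\<^esub> d = (\<lambda>t. c t + d t)"
  "piece (series_ring I) r = {c \<in> sym_series I. \<forall>t. c t \<noteq> 0 \<longrightarrow> mdeg t = r}"
  by (simp_all add: series_ring_def)

lemma poly_ring_simps:
  "carrier (poly_ring I) = sym_polys I" "f \<otimes>\<^bsub>poly_ring I\<^esub> g = f * g"
  "\<one>\<^bsub>poly_ring I\<^esub> = 1" "\<zero>\<^bsub>poly_ring I\<^esub> = 0"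
  "f \<oplus>\<^bsub>poly_ring I\<^esub> g = f + g"
  "piece (poly_ring I) r = {f \<in> sym_polys I. \<forall>t\<in>keys f. mdeg t = r}"
  by (simp_all add: poly_ring_def)

lemma lookup_plus_fun: "lookup (f + g) = (\<lambda>t. lookup f t + lookup g t)"
  by (auto simp: lookup_add)

lemma lookup_one_fun: "lookup (1 :: mpoly) = (\<lambda>t. if t = 0 then 1 else 0)"
  by (auto simp: lookup_one when_def)

lemma lookup_zero_fun: "lookup 0 = (\<lambda>t. 0)"
  by auto

lemma lookup_uminus_fun: "lookup (- f) = (\<lambda>t. - lookup f t)" for f :: mpoly
  by auto

lemma piece_poly_ring_iff: "f \<in> piece (poly_ring I) r \<longleftrightarrow> lookup f \<in> piece (series_ring I) r"
  by (auto simp: poly_ring_simps series_ring_simps lookup_in_sym_series_iff in_keys_iff)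

lemma abelian_group_series_ring: "abelian_group (series_ring I)"
proof (rule abelian_groupI)
  fix c assume "c \<in> carrier (series_ring I)"
  then show "\<exists>d\<in>carrier (series_ring I). d \<oplus>\<^bsub>series_ring I\<^esub> c = \<zero>\<^bsub>series_ring I\<^esub>"
    by (intro bexI[of _ "\<lambda>t. - c t"]) (simp_all add: series_ring_simps sym_series_uminus)
qed (auto simp: series_ring_simps sym_series_zero sym_series_add)

lemma cring_series_ring: "cring (series_ring I)"
proof (rule cringI)
  show "comm_monoid (series_ring I)"
  proof (rule comm_monoidI)
    show "c \<otimes>\<^bsub>series_ring I\<^esub> d = d \<otimes>\<^bsub>series_ring I\<^esub> c" for c d
      by (simp add: series_ring_simps conv_commute[of c d])
  qed (simp_all add: series_ring_simps sym_series_one sym_series_conv conv_assoc conv_one_left)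
qed (simp_all add: abelian_group_series_ring series_ring_simps conv_add_left)

lemma finsum_series_ring:
  assumes "finite F" "\<And>i. i \<in> F \<Longrightarrow> g i \<in> sym_series I"
  shows "(\<Oplus>\<^bsub>series_ring I\<^esub>i\<in>F. g i) t = (\<Sum>i\<in>F. g i t)"
proof -
  interpret abelian_group "series_ring I" by (rule abelian_group_series_ring)
  show ?thesis
    by (rule additive_finsum[where h = "\<lambda>c. c t"]) (use assms in \<open>simp_all add: series_ring_simps\<close>)
qed

text \<open>At a monomial \<open>t\<close> only the component of degree \<open>mdeg t\<close> is
  visible. This gives both the existence of decompositions and their independence.\<close>

lemma sum_of_homogeneous:
  assumes "\<And>r. g r t \<noteq> 0 \<Longrightarrow> mdeg t = r"
  shows "(\<Sum>r<N. g r t) = (if mdeg t < N then g (mdeg t) t else (0 :: int))"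
proof -
  have "(\<Sum>r<N. g r t) = (\<Sum>r<N. if r = mdeg t then g (mdeg t) t else 0)"
    using assms by (intro sum.cong) auto
  then show ?thesis by simp
qed

theorem graded_cring_series_ring: "graded_cring (series_ring I)"
proof (rule graded_cringI)
  interpret cring "series_ring I" by (rule cring_series_ring)
  show "cring (series_ring I)" by (rule cring_series_ring)
  show "subgroup (piece (series_ring I) r) (add_monoid (series_ring I))" for r
  proof (rule group.subgroupI[OF a_group])
    show "piece (series_ring I) r \<noteq> {}"
      using sym_series_zero by (auto simp: series_ring_simps)
    fix c d assume c: "c \<in> piece (series_ring I) r" and d: "d \<in> piece (series_ring I) r"
    have "\<ominus>\<^bsub>series_ring I\<^esub> c = (\<lambda>t. - c t)"
      using c by (intro minus_equality) (simp_all add: series_ring_simps sym_series_uminus)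
    then have "\<ominus>\<^bsub>series_ring I\<^esub> c \<in> piece (series_ring I) r"
      using c by (simp add: series_ring_simps sym_series_uminus)
    then show "inv\<^bsub>add_monoid (series_ring I)\<^esub> c \<in> piece (series_ring I) r"
      by (simp only: a_inv_def)
    have "mdeg t = r" if "c t + d t \<noteq> 0" for t
      using c d that by (cases "c t = 0") (auto simp: series_ring_simps)
    then show "c \<otimes>\<^bsub>add_monoid (series_ring I)\<^esub> d \<in> piece (series_ring I) r"
      using c d by (simp add: series_ring_simps sym_series_add)
  qed (auto simp: series_ring_simps)
  show "\<one>\<^bsub>series_ring I\<^esub> \<in> piece (series_ring I) 0"
    using sym_series_one by (simp add: series_ring_simps)
  show "c \<otimes>\<^bsub>series_ring I\<^esub> d \<in> piece (series_ring I) (r + s)"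
    if "c \<in> piece (series_ring I) r" "d \<in> piece (series_ring I) s" for c d r s
    using that by (auto simp: series_ring_simps sym_series_conv mdeg_plus elim!: conv_nonzeroE)
  show "\<exists>N g. (\<forall>r. g r \<in> piece (series_ring I) r) \<and> c = (\<Oplus>\<^bsub>series_ring I\<^esub>r\<in>{..<N}. g r)"
    if "c \<in> carrier (series_ring I)" for c
  proof -
    have c: "c \<in> sym_series I" using that by (simp add: series_ring_simps)
    then obtain N where N: "\<And>t. c t \<noteq> 0 \<Longrightarrow> mdeg t \<le> N" by (rule sym_seriesE) blast
    define g where "g = (\<lambda>r t. if mdeg t = r then c t else 0)"
    have g: "g r \<in> sym_series I" for r
      using sym_series_restrict_mdeg[OF c] by (simp add: g_def)
    \<comment> \<open>The length is \<open>Suc N\<close> because degree \<open>N\<close> itself may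
      occur.\<close>
    have "c t = (\<Oplus>\<^bsub>series_ring I\<^esub>r\<in>{..<Suc N}. g r) t" for t
    proof -
      have "(\<Oplus>\<^bsub>series_ring I\<^esub>r\<in>{..<Suc N}. g r) t = (\<Sum>r<Suc N. g r t)"
        by (rule finsum_series_ring) (simp_all add: g)
      also have "\<dots> = (if mdeg t < Suc N then g (mdeg t) t else 0)"
        by (rule sum_of_homogeneous) (auto simp: g_def split: if_splits)
      also have "\<dots> = c t"
        using N[of t] by (cases "c t = 0") (auto simp: g_def)
      finally show ?thesis ..
    qed
    moreover have "g r \<in> piece (series_ring I) r" for r
      using g[of r] by (auto simp: series_ring_simps g_def split: if_splits)
    ultimately show ?thesis by blast
  qed
  show "g r = \<zero>\<^bsub>series_ring I\<^esub>"
    if g: "\<And>r. g r \<in> piece (series_ring I) r"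
      and sum: "(\<Oplus>\<^bsub>series_ring I\<^esub>r\<in>{..<N}. g r) = \<zero>\<^bsub>series_ring I\<^esub>" and "r < N" for g N r
  proof
    fix t
    have hom: "mdeg t = s" if "g s t \<noteq> 0" for s
      using g[of s] that by (auto simp: series_ring_simps)
    have "(\<Sum>s<N. g s t) = 0"
      using g fun_cong[OF sum, of t] by (simp add: series_ring_simps finsum_series_ring)
    \<comment> \<open>If \<open>g r t\<close> were nonzero, then \<open>mdeg t = r < N\<close>, and
      the vanishing sum would be equal to \<open>g r t\<close>.\<close>
    then have "g r t = 0"
      using sum_of_homogeneous[of g t N] hom \<open>r < N\<close> by metis
    then show "g r t = \<zero>\<^bsub>series_ring I\<^esub> t" by (simp add: series_ring_simps)
  qed
qed

section \<open>Symmetric polynomials, pulled back from the series along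
  \<open>lookup\<close>\<close>

lemma abelian_group_poly_ring: "abelian_group (poly_ring I)"
proof (rule abelian_groupI)
  fix f assume "f \<in> carrier (poly_ring I)"
  then show "\<exists>g\<in>carrier (poly_ring I). g \<oplus>\<^bsub>poly_ring I\<^esub> f = \<zero>\<^bsub>poly_ring I\<^esub>"
    using sym_series_uminus
    by (intro bexI[of _ "- f"]) (simp_all add: poly_ring_simps lookup_uminus_fun flip: lookup_in_sym_series_iff)
qed (use sym_series_zero sym_series_add in
    \<open>auto simp: poly_ring_simps lookup_zero_fun lookup_plus_fun simp flip: lookup_in_sym_series_iff\<close>)

lemma cring_poly_ring: "cring (poly_ring I)"
proof (rule cringI)
  show "comm_monoid (poly_ring I)"
    by (rule comm_monoidI)
      (use sym_series_one sym_series_conv in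
        \<open>simp_all add: poly_ring_simps lookup_one_fun lookup_times mult_ac flip: lookup_in_sym_series_iff\<close>)
qed (simp_all add: abelian_group_poly_ring poly_ring_simps distrib_right)

lemma lookup_finsum_poly_ring:
  assumes "finite F" "\<And>i. i \<in> F \<Longrightarrow> g i \<in> sym_polys I"
  shows "lookup (\<Oplus>\<^bsub>poly_ring I\<^esub>i\<in>F. g i) = (\<Oplus>\<^bsub>series_ring I\<^esub>i\<in>F. lookup (g i))"
proof
  fix t
  interpret abelian_group "poly_ring I" by (rule abelian_group_poly_ring)
  have "lookup (\<Oplus>\<^bsub>poly_ring I\<^esub>i\<in>F. g i) t = (\<Sum>i\<in>F. lookup (g i) t)"
    by (rule additive_finsum[where h = "\<lambda>f. lookup f t"])
      (use assms in \<open>simp_all add: poly_ring_simps lookup_add\<close>)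
  then show "lookup (\<Oplus>\<^bsub>poly_ring I\<^esub>i\<in>F. g i) t = (\<Oplus>\<^bsub>series_ring I\<^esub>i\<in>F. lookup (g i)) t"
    using assms by (simp add: finsum_series_ring lookup_in_sym_series_iff)
qed

text \<open>\<open>lookup\<close> is injective and respects operations and degrees, so the grading
  axioms are inherited from \<open>series_ring I\<close>. Finiteness of \<open>I\<close> turns the
  homogeneous components, obtained as series, back into polynomials.\<close>

theorem graded_cring_poly_ring:
  assumes "finite I"
  shows "graded_cring (poly_ring I)"
proof (rule graded_cringI)
  interpret cring "poly_ring I" by (rule cring_poly_ring)
  interpret S: graded_cring "series_ring I" by (rule graded_cring_series_ring)
  show "cring (poly_ring I)" by (rule cring_poly_ring)
  have carrier: "f \<in> sym_polys I" if "f \<in> piece (poly_ring I) r" for f r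
    using that by (simp add: poly_ring_simps)
  show "subgroup (piece (poly_ring I) r) (add_monoid (poly_ring I))" for r
  proof (rule group.subgroupI[OF a_group])
    have "0 \<in> piece (poly_ring I) r"
      using S.piece_zero[of r] by (simp only: piece_poly_ring_iff lookup_zero_fun series_ring_simps(4))
    then show "piece (poly_ring I) r \<noteq> {}" by blast
    fix f g assume f: "f \<in> piece (poly_ring I) r" and g: "g \<in> piece (poly_ring I) r"
    have "- f \<in> sym_polys I" "- f \<in> piece (poly_ring I) r"
      using f sym_series_uminus
      by (auto simp: piece_poly_ring_iff series_ring_simps lookup_uminus_fun simp flip: lookup_in_sym_series_iff)
    moreover from this have "\<ominus>\<^bsub>poly_ring I\<^esub> f = - f"
      using f by (intro minus_equality) (simp_all add: poly_ring_simps)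
    ultimately show "inv\<^bsub>add_monoid (poly_ring I)\<^esub> f \<in> piece (poly_ring I) r"
      by (simp add: a_inv_def)
    show "f \<otimes>\<^bsub>add_monoid (poly_ring I)\<^esub> g \<in> piece (poly_ring I) r"
      using S.piece_add[of "lookup f" r "lookup g"] f g
      by (simp add: piece_poly_ring_iff lookup_plus_fun series_ring_simps(5) poly_ring_simps(5))
  qed (auto simp: poly_ring_simps)
  show "\<one>\<^bsub>poly_ring I\<^esub> \<in> piece (poly_ring I) 0"
    using S.piece_one by (simp add: piece_poly_ring_iff lookup_one_fun series_ring_simps(3) poly_ring_simps(3))
  show "f \<otimes>\<^bsub>poly_ring I\<^esub> g \<in> piece (poly_ring I) (r + s)"
    if "f \<in> piece (poly_ring I) r" "g \<in> piece (poly_ring I) s" for f g r s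
    using S.piece_mult[of "lookup f" r "lookup g" s] that
    by (simp add: piece_poly_ring_iff lookup_times series_ring_simps(2) poly_ring_simps(2))
  show "\<exists>N g. (\<forall>r. g r \<in> piece (poly_ring I) r) \<and> f = (\<Oplus>\<^bsub>poly_ring I\<^esub>r\<in>{..<N}. g r)"
    if "f \<in> carrier (poly_ring I)" for f
  proof -
    have "lookup f \<in> carrier (series_ring I)"
      using that by (simp add: poly_ring_simps series_ring_simps lookup_in_sym_series_iff)
    then obtain N c where c: "\<And>r. c r \<in> piece (series_ring I) r"
      and f: "lookup f = (\<Oplus>\<^bsub>series_ring I\<^esub>r\<in>{..<N::nat}. c r)"
      by (rule S.decomposition) blast
    define g where "g r = Abs_poly_mapping (c r)" for r
    have g: "lookup (g r) = c r" for r
      using c[of r] assms by (simp add: g_def series_ring_simps lookup_Abs_sym_series)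
    have piece: "g r \<in> piece (poly_ring I) r" for r
      using c by (simp add: piece_poly_ring_iff g)
    have "f = (\<Oplus>\<^bsub>poly_ring I\<^esub>r\<in>{..<N}. g r)"
      by (intro poly_mapping_eqI) (simp add: lookup_finsum_poly_ring carrier[OF piece] f g)
    with piece show ?thesis by blast
  qed
  show "g r = \<zero>\<^bsub>poly_ring I\<^esub>"
    if g: "\<And>r. g r \<in> piece (poly_ring I) r"
      and sum: "(\<Oplus>\<^bsub>poly_ring I\<^esub>r\<in>{..<N}. g r) = \<zero>\<^bsub>poly_ring I\<^esub>" and "r < N" for g N r
  proof -
    have "(\<Oplus>\<^bsub>series_ring I\<^esub>r\<in>{..<N}. lookup (g r)) = \<zero>\<^bsub>series_ring I\<^esub>"
      using arg_cong[OF sum, of lookup] carrier[OF g]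
      by (simp add: lookup_finsum_poly_ring poly_ring_simps(4) series_ring_simps(4) lookup_zero_fun)
    then have "lookup (g r) = \<zero>\<^bsub>series_ring I\<^esub>"
      using g \<open>r < N\<close> by (intro S.independence[of "\<lambda>r. lookup (g r)"]) (auto simp: piece_poly_ring_iff)
    then show ?thesis
      by (intro poly_mapping_eqI) (simp add: poly_ring_simps(4) series_ring_simps(4))
  qed
qed

section \<open>Setting indeterminates to zero\<close>

lemma set_zero_graded_hom: "set_zero_series Z \<in> graded_hom (series_ring I) (series_ring (I - Z))"
proof (rule graded_homI)
  fix c d :: series
  show "set_zero_series Z (c \<otimes>\<^bsub>series_ring I\<^esub> d)
      = set_zero_series Z c \<otimes>\<^bsub>series_ring (I - Z)\<^esub> set_zero_series Z d"
    by (simp add: series_ring_simps set_zero_series_conv)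
  show "set_zero_series Z (c \<oplus>\<^bsub>series_ring I\<^esub> d)
      = set_zero_series Z c \<oplus>\<^bsub>series_ring (I - Z)\<^esub> set_zero_series Z d"
    by (auto simp: series_ring_simps set_zero_series_def)
next
  fix c r assume "c \<in> piece (series_ring I) r"
  then have "c \<in> sym_series I" "mdeg t = r" if "set_zero_series Z c t \<noteq> 0" for t
    using that by (auto simp: series_ring_simps set_zero_series_def split: if_splits)
  then show "set_zero_series Z c \<in> piece (series_ring (I - Z)) r"
    using \<open>c \<in> piece (series_ring I) r\<close> by (simp add: series_ring_simps sym_series_set_zero)
next
  show "set_zero_series Z \<one>\<^bsub>series_ring I\<^esub> = \<one>\<^bsub>series_ring (I - Z)\<^esub>"
    by (auto simp: series_ring_simps set_zero_series_def)
qed (simp add: series_ring_simps sym_series_set_zero)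

lemma set_zero_poly_graded_hom: "set_zero Z \<in> graded_hom (poly_ring I) (poly_ring (I - Z))"
proof (rule graded_homI)
  fix f g assume "f \<in> carrier (poly_ring I)" "g \<in> carrier (poly_ring I)"
  show "set_zero Z (f \<otimes>\<^bsub>poly_ring I\<^esub> g) = set_zero Z f \<otimes>\<^bsub>poly_ring (I - Z)\<^esub> set_zero Z g"
    by (rule poly_mapping_eqI) (simp add: poly_ring_simps lookup_set_zero lookup_times set_zero_series_conv)
  show "set_zero Z (f \<oplus>\<^bsub>poly_ring I\<^esub> g) = set_zero Z f \<oplus>\<^bsub>poly_ring (I - Z)\<^esub> set_zero Z g"
    by (rule poly_mapping_eqI) (simp add: poly_ring_simps lookup_set_zero lookup_add set_zero_series_def)
next
  show "set_zero Z \<one>\<^bsub>poly_ring I\<^esub> = \<one>\<^bsub>poly_ring (I - Z)\<^esub>"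
    by (rule poly_mapping_eqI) (auto simp: poly_ring_simps lookup_set_zero lookup_one_fun set_zero_series_def)
qed (use graded_hom_piece[OF set_zero_graded_hom] sym_series_set_zero in
    \<open>auto simp: piece_poly_ring_iff poly_ring_simps(1) lookup_set_zero simp flip: lookup_in_sym_series_iff\<close>)

text \<open>The passage from series to polynomials: once only finitely many indeterminates remain,
  the truncated series has finite support.\<close>

lemma Abs_set_zero_graded_hom:
  assumes "finite (I - Z)"
  shows "(\<lambda>c. Abs_poly_mapping (set_zero_series Z c)) \<in> graded_hom (series_ring I) (poly_ring (I - Z))"
proof (rule graded_homI)
  note lookup = lookup_Abs_sym_series[OF assms sym_series_set_zero]
  fix c d assume c: "c \<in> carrier (series_ring I)" and d: "d \<in> carrier (series_ring I)"
  then have cd: "conv c d \<in> sym_series I" "(\<lambda>t. c t + d t) \<in> sym_series I"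
    by (simp_all add: series_ring_simps sym_series_conv sym_series_add)
  show "Abs_poly_mapping (set_zero_series Z c) \<in> carrier (poly_ring (I - Z))"
    using c by (simp add: series_ring_simps poly_ring_simps lookup sym_series_set_zero flip: lookup_in_sym_series_iff)
  show "Abs_poly_mapping (set_zero_series Z (c \<otimes>\<^bsub>series_ring I\<^esub> d))
      = Abs_poly_mapping (set_zero_series Z c) \<otimes>\<^bsub>poly_ring (I - Z)\<^esub> Abs_poly_mapping (set_zero_series Z d)"
    using c d cd
    by (intro poly_mapping_eqI) (simp add: series_ring_simps poly_ring_simps lookup lookup_times flip: set_zero_series_conv)
  show "Abs_poly_mapping (set_zero_series Z (c \<oplus>\<^bsub>series_ring I\<^esub> d))
      = Abs_poly_mapping (set_zero_series Z c) \<oplus>\<^bsub>poly_ring (I - Z)\<^esub> Abs_poly_mapping (set_zero_series Z d)"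
    using c d cd
    by (intro poly_mapping_eqI)
      (simp add: series_ring_simps poly_ring_simps lookup lookup_add, simp add: set_zero_series_def)
next
  show "Abs_poly_mapping (set_zero_series Z \<one>\<^bsub>series_ring I\<^esub>) = \<one>\<^bsub>poly_ring (I - Z)\<^esub>"
    using ring_hom_one[OF graded_hom_ring_hom[OF set_zero_graded_hom[of Z I]]]
    by (intro poly_mapping_eqI)
      (simp add: series_ring_simps poly_ring_simps lookup_one_fun lookup_Abs_sym_series[OF assms] sym_series_one)
next
  fix c r assume c: "c \<in> piece (series_ring I) r"
  then have "lookup (Abs_poly_mapping (set_zero_series Z c)) = set_zero_series Z c"
    by (simp add: series_ring_simps(6) lookup_Abs_sym_series[OF assms] sym_series_set_zero)
  with graded_hom_piece[OF set_zero_graded_hom c]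
  show "Abs_poly_mapping (set_zero_series Z c) \<in> piece (poly_ring (I - Z)) r"
    by (simp add: piece_poly_ring_iff)
qed

lemma set_zero_series_set_zero_series:
  "set_zero_series Z (set_zero_series Z' c) = set_zero_series (Z \<union> Z') c"
  by (auto simp: set_zero_series_def Int_Un_distrib)

lemma set_zero_set_zero: "set_zero Z (set_zero Z' f) = set_zero (Z \<union> Z') f"
  by (rule poly_mapping_eqI) (simp add: lookup_set_zero set_zero_series_set_zero_series)

lemma set_zero_sym_polys: "f \<in> sym_polys I \<Longrightarrow> set_zero Z f \<in> sym_polys (I - Z)"
  by (simp add: lookup_set_zero sym_series_set_zero flip: lookup_in_sym_series_iff)

text \<open>Only the part of \<open>Z\<close> inside \<open>I\<close> matters, so the sets in
  \<open>h_proj\<close> and \<open>v_proj\<close> can be exchanged for \<open>above m\<close> and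
  \<open>longer k\<close>, which mention a single index.\<close>

lemma set_zero_cong:
  assumes "f \<in> sym_polys I" "Z \<inter> I = Z' \<inter> I"
  shows "set_zero Z f = set_zero Z' f"
proof (rule poly_mapping_eqI)
  fix t
  have "keys t \<inter> Z = keys t \<inter> Z'" if "lookup f t \<noteq> 0"
  proof -
    have "keys t \<subseteq> I"
      using assms(1) that by (auto simp: sym_polys_def in_keys_iff)
    with assms(2) show ?thesis by blast
  qed
  then show "lookup (set_zero Z f) t = lookup (set_zero Z' f) t"
    by (auto simp: lookup_set_zero set_zero_series_def)
qed

lemma set_zero_disjoint:
  assumes "f \<in> sym_polys I" "Z \<inter> I = {}"
  shows "set_zero Z f = f"
proof -
  have "set_zero Z f = set_zero {} f"
    using assms by (intro set_zero_cong) auto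
  also have "\<dots> = f"
    by (rule poly_mapping_eqI) (simp add: lookup_set_zero set_zero_series_def)
  finally show ?thesis .
qed

section \<open>The arrows of the diagram\<close>

abbreviation (input) above :: "nat \<Rightarrow> indet set" where
  "above m \<equiv> {(p, \<mu>). p > m}"

abbreviation (input) longer :: "nat \<Rightarrow> indet set" where
  "longer k \<equiv> {(p, \<mu>). length \<mu> > k}"

lemma finite_indets: "finite (indets n m k)"
proof -
  have "indets n m k \<subseteq> {..m} \<times> {\<mu>. set \<mu> \<subseteq> {1..n} \<and> length \<mu> \<le> k}"
    by (auto simp: indets_def all_indets_def)
  then show ?thesis
    by (rule finite_subset) (simp add: finite_lists_length_le)
qed

lemma indets_Diff_above: "m \<le> m' \<Longrightarrow> indets n m' k - above m = indets n m k"
  by (auto simp: indets_def)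

lemma indets_Diff_longer: "k \<le> k' \<Longrightarrow> indets n m k' - longer k = indets n m k"
  by (auto simp: indets_def)

lemma all_indets_Diff: "all_indets n - (longer k \<union> above m) = indets n m k"
  by (auto simp: indets_def)

lemma graded_cring_Lam_mk: "graded_cring (Lam_mk n m k)"
  unfolding Lam_mk_eq by (rule graded_cring_poly_ring[OF finite_indets])

lemma carrier_Lam_mk: "carrier (Lam_mk n m k) = sym_polys (indets n m k)"
  by (simp add: Lam_mk_def)

text \<open>The last map in the list acts first. In \<open>phi_k\<close> and \<open>psi_m\<close> it
  is the one with the largest index, which an induction on the upper index peels off.\<close>

lemma foldr_comp_snoc: "foldr (\<circ>) (fs @ [f]) id x = foldr (\<circ>) fs id (f x)"
  by (induction fs) auto

text \<open>In the source ring \<open>p\<close> is at most \<open>Suc m\<close>, so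
  \<open>p = Suc m\<close> and \<open>p > m\<close> say the same.\<close>

lemma h_proj_eq:
  assumes "f \<in> sym_polys (indets n (Suc m) k)"
  shows "h_proj n (Suc m) k f = set_zero (above m) f"
  unfolding h_proj_def by (rule set_zero_cong[OF assms]) (auto simp: indets_def)

lemma v_proj_eq:
  assumes "f \<in> sym_polys (indets n m (Suc k))"
  shows "v_proj n m (Suc k) f = set_zero (longer k) f"
  unfolding v_proj_def by (rule set_zero_cong[OF assms]) (auto simp: indets_def)

lemma phi_k_eq:
  assumes "m1 \<le> m2" "f \<in> sym_polys (indets n m2 k)"
  shows "phi_k n m2 m1 k f = set_zero (above m1) f"
  using assms
\<comment> \<open>\<open>f\<close> is generalised because the induction hypothesis is applied to a
  truncation of it.\<close>
proof (induction m2 arbitrary: f rule: dec_induct)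
  case base
  then show ?case
    by (subst set_zero_disjoint[OF base]) (auto simp: phi_k_def indets_def)
next
  case (step m2)
  have "[m1 + 1..<Suc m2 + 1] = [m1 + 1..<m2 + 1] @ [Suc m2]"
    using step.hyps by simp
  then have "phi_k n (Suc m2) m1 k f = phi_k n m2 m1 k (h_proj n (Suc m2) k f)"
    unfolding phi_k_def by (simp only: map_append list.map foldr_comp_snoc)
  also have "\<dots> = phi_k n m2 m1 k (set_zero (above m2) f)"
    by (simp add: h_proj_eq step.prems)
  also have "\<dots> = set_zero (above m1) (set_zero (above m2) f)"
    using set_zero_sym_polys[OF step.prems, of "above m2"] by (intro step.IH) (simp add: indets_Diff_above)
  \<comment> \<open>The lower bound removes everything that the higher one removes, so the composite
    collapses to a single truncation.\<close>
  also have "above m1 \<union> above m2 = above m1"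
    using step.hyps by auto
  then have "set_zero (above m1) (set_zero (above m2) f) = set_zero (above m1) f"
    by (simp add: set_zero_set_zero)
  finally show ?case .
qed

lemma psi_m_eq:
  assumes "k1 \<le> k2" "f \<in> sym_polys (indets n m k2)"
  shows "psi_m n m k2 k1 f = set_zero (longer k1) f"
  using assms
proof (induction k2 arbitrary: f rule: dec_induct)
  case base
  then show ?case
    by (subst set_zero_disjoint[OF base]) (auto simp: psi_m_def indets_def)
next
  case (step k2)
  have "[k1 + 1..<Suc k2 + 1] = [k1 + 1..<k2 + 1] @ [Suc k2]"
    using step.hyps by simp
  then have "psi_m n m (Suc k2) k1 f = psi_m n m k2 k1 (v_proj n m (Suc k2) f)"
    unfolding psi_m_def by (simp only: map_append list.map foldr_comp_snoc)
  also have "\<dots> = psi_m n m k2 k1 (set_zero (longer k2) f)"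
    by (simp add: v_proj_eq step.prems)
  also have "\<dots> = set_zero (longer k1) (set_zero (longer k2) f)"
    using set_zero_sym_polys[OF step.prems, of "longer k2"] by (intro step.IH) (simp add: indets_Diff_longer)
  also have "longer k1 \<union> longer k2 = longer k1"
    using step.hyps by auto
  then have "set_zero (longer k1) (set_zero (longer k2) f) = set_zero (longer k1) f"
    by (simp add: set_zero_set_zero)
  finally show ?case .
qed

text \<open>The arrows agree with truncations only on carriers. In a graded ring the pieces, the
  unit, sums and products all lie there, so the homomorphism property transfers.\<close>

lemma graded_hom_cong:
  assumes "graded_cring R" "f \<in> graded_hom R S" "\<And>x. x \<in> carrier R \<Longrightarrow> g x = f x"
  shows "g \<in> graded_hom R S"
proof -
  interpret graded_cring R by fact
  note hom = graded_hom_ring_hom[OF assms(2)]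
  show ?thesis
    by (rule graded_homI)
      (simp_all add: assms(3) ring_hom_closed[OF hom] ring_hom_mult[OF hom] ring_hom_add[OF hom]
        ring_hom_one[OF hom] piece_carrier graded_hom_piece[OF assms(2)])
qed

lemma phi_k_graded_hom:
  assumes "m1 \<le> m2"
  shows "phi_k n m2 m1 k \<in> graded_hom (Lam_mk n m2 k) (Lam_mk n m1 k)"
proof (rule graded_hom_cong[OF graded_cring_Lam_mk])
  show "set_zero (above m1) \<in> graded_hom (Lam_mk n m2 k) (Lam_mk n m1 k)"
    using set_zero_poly_graded_hom[of "above m1" "indets n m2 k"]
    by (simp add: indets_Diff_above[OF assms] Lam_mk_eq)
qed (simp add: phi_k_eq[OF assms] carrier_Lam_mk)

lemma psi_m_graded_hom:
  assumes "k1 \<le> k2"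
  shows "psi_m n m k2 k1 \<in> graded_hom (Lam_mk n m k2) (Lam_mk n m k1)"
proof (rule graded_hom_cong[OF graded_cring_Lam_mk])
  show "set_zero (longer k1) \<in> graded_hom (Lam_mk n m k2) (Lam_mk n m k1)"
    using set_zero_poly_graded_hom[of "longer k1" "indets n m k2"]
    by (simp add: indets_Diff_longer[OF assms] Lam_mk_eq)
qed (simp add: psi_m_eq[OF assms] carrier_Lam_mk)

lemma h_proj_eq_phi_k: "f \<in> carrier (Lam_mk n (Suc m) k) \<Longrightarrow> h_proj n (Suc m) k f = phi_k n (Suc m) m k f"
  by (simp add: carrier_Lam_mk h_proj_eq phi_k_eq)

lemma v_proj_eq_psi_m: "f \<in> carrier (Lam_mk n m (Suc k)) \<Longrightarrow> v_proj n m (Suc k) f = psi_m n m (Suc k) k f"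
  by (simp add: carrier_Lam_mk v_proj_eq psi_m_eq)

text \<open>Both composites set \<open>above m1 \<union> longer k1\<close> to zero. This gives the
  squares among the \<open>Lam_mk\<close> and also makes \<open>phi\<close> and \<open>psi\<close>
  respect compatible sequences.\<close>

lemma psi_m_phi_k_commute:
  assumes "m1 \<le> m2" "k1 \<le> k2" "f \<in> carrier (Lam_mk n m2 k2)"
  shows "psi_m n m1 k2 k1 (phi_k n m2 m1 k2 f) = phi_k n m2 m1 k1 (psi_m n m2 k2 k1 f)"
proof -
  have f: "f \<in> sym_polys (indets n m2 k2)"
    using assms(3) by (simp add: carrier_Lam_mk)
  have "set_zero (above m1) f \<in> sym_polys (indets n m1 k2)"
    "set_zero (longer k1) f \<in> sym_polys (indets n m2 k1)"
    using set_zero_sym_polys[OF f, of "above m1"] set_zero_sym_polys[OF f, of "longer k1"]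
    by (simp_all add: indets_Diff_above indets_Diff_longer assms)
  then show ?thesis
    using assms(1,2) f by (simp add: phi_k_eq psi_m_eq set_zero_set_zero Un_commute)
qed

section \<open>The limits in one direction and the arrows into and out of them\<close>

interpretation k: inverse_system "{1..}" "\<lambda>m. Lam_mk n m k" "\<lambda>m. h_proj n m k" for n k
  by (rule inverse_system.intro)
    (auto simp: graded_cring_Lam_mk h_proj_eq_phi_k
      intro!: graded_hom_cong[OF graded_cring_Lam_mk phi_k_graded_hom])

interpretation m: inverse_system "{0..}" "\<lambda>k. Lam_mk n m k" "\<lambda>k. v_proj n m k" for n m
  by (rule inverse_system.intro)
    (auto simp: graded_cring_Lam_mk v_proj_eq_psi_m
      intro!: graded_hom_cong[OF graded_cring_Lam_mk psi_m_graded_hom])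

text \<open>Picking a term and then applying \<open>phi_k\<close> gives a family of maps to the
  target system. Its compatibility is the commutation of \<open>phi_k\<close> with the one-step map
  \<open>v_proj\<close>, read as \<open>psi_m\<close> from \<open>Suc k\<close> to
  \<open>k\<close>.\<close>

lemma phi_graded_hom:
  assumes "m1 \<le> m2"
  shows "phi n m2 m1 \<in> graded_hom (Lam_m n m2) (Lam_m n m1)"
proof -
  have "(\<lambda>f. \<lambda>k\<in>{0..}. phi_k n m2 m1 k (f k)) \<in> graded_hom (Lam_m n m2) (Lam_m n m1)"
    unfolding Lam_m_def
  proof (rule m.universal_graded_hom[OF m.graded_cring_L])
    fix k :: nat assume k: "k \<in> {0..}"
    show "(\<lambda>f. phi_k n m2 m1 k (f k)) \<in> graded_hom (m.L n m2) (Lam_mk n m1 k)"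
      using k by (intro graded_hom_compose[OF m.eval_graded_hom] phi_k_graded_hom assms)
    fix f assume "f \<in> carrier (m.L n m2)"
    then have f: "f (Suc k) \<in> carrier (Lam_mk n m2 (Suc k))" "f k = v_proj n m2 (Suc k) (f (Suc k))"
      using m.carrier_carrier m.carrier_compatible[OF _ k] by auto
    have "phi_k n m2 m1 (Suc k) (f (Suc k)) \<in> carrier (Lam_mk n m1 (Suc k))"
      using f(1) by (rule ring_hom_closed[OF graded_hom_ring_hom[OF phi_k_graded_hom[OF assms]]])
    then show "v_proj n m1 (Suc k) (phi_k n m2 m1 (Suc k) (f (Suc k))) = phi_k n m2 m1 k (f k)"
      using f assms by (simp add: v_proj_eq_psi_m psi_m_phi_k_commute)
  qed
  then show ?thesis by (simp add: phi_def[abs_def])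
qed

lemma psi_graded_hom:
  assumes "k1 \<le> k2"
  shows "psi n k2 k1 \<in> graded_hom (Lam_k n k2) (Lam_k n k1)"
proof -
  have "(\<lambda>f. \<lambda>m\<in>{1..}. psi_m n m k2 k1 (f m)) \<in> graded_hom (Lam_k n k2) (Lam_k n k1)"
    unfolding Lam_k_def
  proof (rule k.universal_graded_hom[OF k.graded_cring_L])
    fix m :: nat assume m: "m \<in> {1..}"
    show "(\<lambda>f. psi_m n m k2 k1 (f m)) \<in> graded_hom (k.L n k2) (Lam_mk n m k1)"
      using m by (intro graded_hom_compose[OF k.eval_graded_hom] psi_m_graded_hom assms)
    fix f assume "f \<in> carrier (k.L n k2)"
    then have f: "f (Suc m) \<in> carrier (Lam_mk n (Suc m) k2)" "f m = h_proj n (Suc m) k2 (f (Suc m))"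
      using k.carrier_carrier k.carrier_compatible[OF _ m] by auto
    have "psi_m n (Suc m) k2 k1 (f (Suc m)) \<in> carrier (Lam_mk n (Suc m) k1)"
      using f(1) by (rule ring_hom_closed[OF graded_hom_ring_hom[OF psi_m_graded_hom[OF assms]]])
    then show "h_proj n (Suc m) k1 (psi_m n (Suc m) k2 k1 (f (Suc m))) = psi_m n m k2 k1 (f m)"
      using f assms by (simp add: h_proj_eq_phi_k psi_m_phi_k_commute)
  qed
  then show ?thesis by (simp add: psi_def[abs_def])
qed

text \<open>The direct map from \<open>Lam n\<close> to the finite level \<open>(m, k)\<close>:
  exactly \<open>indets n m k\<close> survives. \<open>H_proj\<close> collects these maps for fixed
  \<open>m\<close>, \<open>V_proj\<close> for fixed \<open>k\<close>.\<close>

lemma truncation_graded_hom: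
  "(\<lambda>c. Abs_poly_mapping (set_zero_series (longer k \<union> above m) c)) \<in> graded_hom (Lam n) (Lam_mk n m k)"
  using Abs_set_zero_graded_hom[of "all_indets n" "longer k \<union> above m"]
  by (simp add: all_indets_Diff finite_indets Lam_eq Lam_mk_eq)

lemma
  assumes "c \<in> carrier (Lam n)"
  shows truncation_carrier:
      "Abs_poly_mapping (set_zero_series (longer k \<union> above m) c) \<in> sym_polys (indets n m k)"
    and lookup_truncation:
      "lookup (Abs_poly_mapping (set_zero_series (longer k \<union> above m) c)) = set_zero_series (longer k \<union> above m) c"
proof -
  have "set_zero_series (longer k \<union> above m) c \<in> sym_series (indets n m k)"
    using assms sym_series_set_zero[of c "all_indets n" "longer k \<union> above m"]
    by (simp add: Lam_def all_indets_Diff)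
  then show "lookup (Abs_poly_mapping (set_zero_series (longer k \<union> above m) c)) = set_zero_series (longer k \<union> above m) c"
    by (rule lookup_Abs_sym_series[OF finite_indets])
  show "Abs_poly_mapping (set_zero_series (longer k \<union> above m) c) \<in> sym_polys (indets n m k)"
    using ring_hom_closed[OF graded_hom_ring_hom[OF truncation_graded_hom] assms]
    by (simp add: carrier_Lam_mk)
qed

lemma H_proj_eq:
  "H_proj m = (\<lambda>c. \<lambda>k\<in>{0..}. Abs_poly_mapping (set_zero_series (longer k \<union> above m) c))"
  by (simp add: H_proj_def[abs_def] set_zero_series_set_zero_series)

lemma V_proj_eq:
  "V_proj k = (\<lambda>c. \<lambda>m\<in>{1..}. Abs_poly_mapping (set_zero_series (longer k \<union> above m) c))"
  by (simp add: V_proj_def[abs_def] set_zero_series_set_zero_series Un_commute)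

lemma H_proj_graded_hom: "H_proj m \<in> graded_hom (Lam n) (Lam_m n m)"
  unfolding Lam_m_def H_proj_eq
proof (rule m.universal_graded_hom[OF _ truncation_graded_hom])
  show "graded_cring (Lam n)"
    unfolding Lam_eq by (rule graded_cring_series_ring)
  fix k and c :: series assume c: "c \<in> carrier (Lam n)"
  \<comment> \<open>Indeterminates longer than \<open>Suc k\<close> are already longer than
    \<open>k\<close>, so the next transition map leads to the truncation at level
    \<open>k\<close>.\<close>
  have "longer k \<union> (longer (Suc k) \<union> above m) = longer k \<union> above m" by auto
  then show "v_proj n m (Suc k) (Abs_poly_mapping (set_zero_series (longer (Suc k) \<union> above m) c))
      = Abs_poly_mapping (set_zero_series (longer k \<union> above m) c)"
    by (intro poly_mapping_eqI)
      (simp add: v_proj_eq truncation_carrier[OF c] lookup_set_zero lookup_truncation[OF c]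
        set_zero_series_set_zero_series)
qed

lemma V_proj_graded_hom: "V_proj k \<in> graded_hom (Lam n) (Lam_k n k)"
  unfolding Lam_k_def V_proj_eq
proof (rule k.universal_graded_hom[OF _ truncation_graded_hom])
  show "graded_cring (Lam n)"
    unfolding Lam_eq by (rule graded_cring_series_ring)
  fix m and c :: series assume c: "c \<in> carrier (Lam n)"
  have "above m \<union> (longer k \<union> above (Suc m)) = longer k \<union> above m" by auto
  then show "h_proj n (Suc m) k (Abs_poly_mapping (set_zero_series (longer k \<union> above (Suc m)) c))
      = Abs_poly_mapping (set_zero_series (longer k \<union> above m) c)"
    by (intro poly_mapping_eqI)
      (simp add: h_proj_eq truncation_carrier[OF c] lookup_set_zero lookup_truncation[OF c]
        set_zero_series_set_zero_series)
qed

lemma V_mk_graded_hom: "V_mk m k \<in> graded_hom (Lam_m n m) (Lam_mk n m k)"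
  unfolding Lam_m_def V_mk_def[abs_def] by (rule m.eval_graded_hom) simp

lemma H_mk_graded_hom: "m \<ge> 1 \<Longrightarrow> H_mk m k \<in> graded_hom (Lam_k n k) (Lam_mk n m k)"
  unfolding Lam_k_def H_mk_def[abs_def] by (rule k.eval_graded_hom) simp

lemma graded_cring_Lams:
  "graded_cring (Lam n)" "graded_cring (Lam_m n m)" "graded_cring (Lam_k n k)" "graded_cring (Lam_mk n m k)"
  unfolding Lam_m_def Lam_k_def Lam_eq
  by (fact graded_cring_series_ring m.graded_cring_L k.graded_cring_L graded_cring_Lam_mk)+

section \<open>The squares\<close>

text \<open>Both paths pick the same polynomial, the truncation at level \<open>(m, k)\<close>. The
  bound on \<open>m\<close> places it in the index set of the limit over \<open>m\<close>.\<close>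

lemma comm_square_corner:
  assumes "m \<ge> 1"
  shows "comm_square (Lam n) (H_proj m) (Lam_m n m) (V_proj k) (V_mk m k) (Lam_k n k) (H_mk m k) (Lam_mk n m k)"
  using assms unfolding comm_square_def
  by (simp add: graded_cring_Lams H_proj_graded_hom V_proj_graded_hom V_mk_graded_hom H_mk_graded_hom)
    (simp add: V_mk_def H_mk_def H_proj_eq V_proj_eq)

text \<open>\<open>phi\<close> acts termwise, so picking the term at \<open>k\<close> before or
  after gives the same value by definition; \<open>comm_square_left\<close> is the analogue for
  \<open>psi\<close>.\<close>

lemma comm_square_top:
  assumes "m1 \<le> m2"
  shows "comm_square (Lam_m n m2) (phi n m2 m1) (Lam_m n m1) (V_mk m2 k) (V_mk m1 k)
    (Lam_mk n m2 k) (phi_k n m2 m1 k) (Lam_mk n m1 k)"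
  using assms unfolding comm_square_def
  by (simp add: graded_cring_Lams phi_graded_hom phi_k_graded_hom V_mk_graded_hom)
    (simp add: V_mk_def phi_def)

lemma comm_square_left:
  assumes "m \<ge> 1" "k1 \<le> k2"
  shows "comm_square (Lam_k n k2) (H_mk m k2) (Lam_mk n m k2) (psi n k2 k1) (psi_m n m k2 k1)
    (Lam_k n k1) (H_mk m k1) (Lam_mk n m k1)"
  using assms unfolding comm_square_def
  by (simp add: graded_cring_Lams psi_graded_hom psi_m_graded_hom H_mk_graded_hom)
    (simp add: H_mk_def psi_def)

lemma comm_square_inner:
  assumes "m1 \<le> m2" "k1 \<le> k2"
  shows "comm_square (Lam_mk n m2 k2) (phi_k n m2 m1 k2) (Lam_mk n m1 k2) (psi_m n m2 k2 k1) (psi_m n m1 k2 k1)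
    (Lam_mk n m2 k1) (phi_k n m2 m1 k1) (Lam_mk n m1 k1)"
  using assms unfolding comm_square_def
  by (simp add: graded_cring_Lams psi_m_graded_hom phi_k_graded_hom psi_m_phi_k_commute)

theorem theorem3:
  fixes n m k p q :: nat
  assumes "n \<ge> 1" and "m \<ge> 2" and "k \<ge> 1"
  shows
    "comm_square
       (Lam n)                     (H_proj (m + p))        (Lam_m n (m + p))
       (V_proj (k + q))            (V_mk (m + p) (k + q))
       (Lam_k n (k + q))           (H_mk (m + p) (k + q))  (Lam_mk n (m + p) (k + q))
     \<and> comm_square
       (Lam_m n (m + p))           (phi n (m + p) m)            (Lam_m n m)
       (V_mk (m + p) (k + q))      (V_mk m (k + q))
       (Lam_mk n (m + p) (k + q))  (phi_k n (m + p) m (k + q))  (Lam_mk n m (k + q))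
     \<and> comm_square
       (Lam_m n m)                 (phi n m (m - 1))            (Lam_m n (m - 1))
       (V_mk m (k + q))            (V_mk (m - 1) (k + q))
       (Lam_mk n m (k + q))        (phi_k n m (m - 1) (k + q))  (Lam_mk n (m - 1) (k + q))
     \<and> comm_square
       (Lam_k n (k + q))           (H_mk (m + p) (k + q))  (Lam_mk n (m + p) (k + q))
       (psi n (k + q) k)           (psi_m n (m + p) (k + q) k)
       (Lam_k n k)                 (H_mk (m + p) k)        (Lam_mk n (m + p) k)
     \<and> comm_square
       (Lam_mk n (m + p) (k + q))  (phi_k n (m + p) m (k + q))  (Lam_mk n m (k + q))
       (psi_m n (m + p) (k + q) k) (psi_m n m (k + q) k)
       (Lam_mk n (m + p) k)        (phi_k n (m + p) m k)        (Lam_mk n m k)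
     \<and> comm_square
       (Lam_mk n m (k + q))        (phi_k n m (m - 1) (k + q))  (Lam_mk n (m - 1) (k + q))
       (psi_m n m (k + q) k)       (psi_m n (m - 1) (k + q) k)
       (Lam_mk n m k)              (phi_k n m (m - 1) k)        (Lam_mk n (m - 1) k)
     \<and> comm_square
       (Lam_k n k)                 (H_mk (m + p) k)        (Lam_mk n (m + p) k)
       (psi n k (k - 1))           (psi_m n (m + p) k (k - 1))
       (Lam_k n (k - 1))           (H_mk (m + p) (k - 1))  (Lam_mk n (m + p) (k - 1))
     \<and> comm_square
       (Lam_mk n (m + p) k)        (phi_k n (m + p) m k)        (Lam_mk n m k)
       (psi_m n (m + p) k (k - 1)) (psi_m n m k (k - 1))
       (Lam_mk n (m + p) (k - 1))  (phi_k n (m + p) m (k - 1))  (Lam_mk n m (k - 1))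
     \<and> comm_square
       (Lam_mk n m k)              (phi_k n m (m - 1) k)        (Lam_mk n (m - 1) k)
       (psi_m n m k (k - 1))       (psi_m n (m - 1) k (k - 1))
       (Lam_mk n m (k - 1))        (phi_k n m (m - 1) (k - 1))  (Lam_mk n (m - 1) (k - 1))"
  \<comment> \<open>The nine squares are one corner, two in the top row, two in the left column and
    four among the \<open>Lam_mk\<close>; what remains are inequalities between indices.\<close>
  using assms
  by (intro conjI comm_square_corner comm_square_top comm_square_left comm_square_inner) auto

end
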